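(* Let $\mu$ be a finite complex Borel measure on $\mathbb{C}$ and let $E=\{z\in\mathbb{C}: C^{\mu}(z)\text{ exists and } C^{\mu}(z)=0\}$. Let $w\in\mathbb{C}$ be a point of density of $E$ with respect to two-dimensional Lebesgue measure $m_2$, and suppose that the Radon derivative $\frac{d|\mu|}{dm_2}(w)$ exists (as a finite limit) and is nonzero. Then $$\mu(B(w,r))=o\big(|\mu|(B(w,r))\big)\quad\text{as } r\to0+,$$ and $\frac{d\mu}{dm_2}(w)=0$.
   Context: $C^{\mu}(z)=\lim_{\varepsilon\to 0}\int_{|\zeta-z|>\varepsilon}\frac{d\mu(\zeta)}{\zeta-z}$ whenever the limit exists. $B(w,r)$ is the disc of radius $r$ centered at $w$. For a finite complex measure $\nu$ on $\mathbb{C}$, the Radon derivative at $w$ is $\frac{d\nu}{dm_2}(w)=\lim_{r\to0+}\frac{\nu(B(w,r))}{m_2(B(w,r))}$ when the limit exists. A point $w$ is a point of density of $E$ if $\lim_{r\to0+} m_2(E\cap B(w,r))/m_2(B(w,r))=1$. *)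

theory Defs
  imports "HOL-Analysis.Analysis" "HOL-Library.Landau_Symbols"
begin

text \<open>
  A finite complex Borel measure on the plane is a countably additive complex-valued function
  of Borel sets; its values on other sets are unconstrained and never used. The condition
  \<open>\<mu> {} = 0\<close> is implied: take \<open>A i = {}\<close> for all \<open>i\<close>.
\<close>

definition complex_measure :: "(complex set \<Rightarrow> complex) \<Rightarrow> bool" where
  "complex_measure \<mu> \<longleftrightarrow>
     (\<forall>A :: nat \<Rightarrow> complex set. range A \<subseteq> sets borel \<longrightarrow> disjoint_family A \<longrightarrow>
        (\<lambda>i. \<mu> (A i)) sums \<mu> (\<Union>i. A i))"

text \<open>
  The total variation measure: the supremum of \<open>\<Sum>i. norm (\<mu> (P i))\<close> over the countable
  Borel partitions of a set. \<open>measure_of\<close> returns this set function on Borel sets if it is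
  countably additive (and the null measure otherwise), which is the case for a complex measure.
\<close>

definition total_variation :: "(complex set \<Rightarrow> complex) \<Rightarrow> complex measure" where
  "total_variation \<mu> = measure_of UNIV (sets borel)
     (\<lambda>A. SUP P \<in> {P :: nat \<Rightarrow> complex set.
                     range P \<subseteq> sets borel \<and> disjoint_family P \<and> (\<Union>i. P i) = A}.
            \<Sum>i. ennreal (norm (\<mu> (P i))))"

text \<open>
  The upper variation of a finite signed measure \<open>\<nu>\<close>, i.e. the positive part \<open>\<nu>\<^sup>+\<close> of its Jordan
  decomposition; the negative part is the upper variation of \<open>-\<nu>\<close>. Negative values of \<open>\<nu>\<close> are
  truncated to 0 by \<open>ennreal\<close>, which does not change the supremum because \<open>B = {}\<close> is allowed.
\<close>

definition upper_variation :: "(complex set \<Rightarrow> real) \<Rightarrow> complex measure" where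
  "upper_variation \<nu> = measure_of UNIV (sets borel)
     (\<lambda>A. SUP B \<in> {B \<in> sets borel. B \<subseteq> A}. ennreal (\<nu> B))"

text \<open>
  Integration against \<open>\<mu> = (Re \<mu>)\<^sup>+ - (Re \<mu>)\<^sup>- + \<i> ((Im \<mu>)\<^sup>+ - (Im \<mu>)\<^sup>-)\<close>.
\<close>

definition complex_measure_integral ::
    "(complex set \<Rightarrow> complex) \<Rightarrow> (complex \<Rightarrow> complex) \<Rightarrow> complex" where
  "complex_measure_integral \<mu> f =
     (\<integral>x. f x \<partial>upper_variation (\<lambda>A. Re (\<mu> A))) - (\<integral>x. f x \<partial>upper_variation (\<lambda>A. - Re (\<mu> A)))
     + \<i> * ((\<integral>x. f x \<partial>upper_variation (\<lambda>A. Im (\<mu> A))) - (\<integral>x. f x \<partial>upper_variation (\<lambda>A. - Im (\<mu> A))))"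

text \<open>\<open>has_cauchy_transform \<mu> z c\<close> says that \<open>C\<^sup>\<mu>(z)\<close> exists (as a principal value) and equals \<open>c\<close>.\<close>

definition has_cauchy_transform ::
    "(complex set \<Rightarrow> complex) \<Rightarrow> complex \<Rightarrow> complex \<Rightarrow> bool" where
  "has_cauchy_transform \<mu> z c \<longleftrightarrow>
     ((\<lambda>\<epsilon>. complex_measure_integral \<mu>
              (\<lambda>\<zeta>. indicator {\<zeta>. norm (\<zeta> - z) > \<epsilon>} \<zeta> *\<^sub>R (1 / (\<zeta> - z)))) \<longlongrightarrow> c) (at_right 0)"

text \<open>
  The derivative at \<open>w\<close> with respect to \<open>m\<^sub>2\<close> exists as a finite limit and equals \<open>L\<close>. The
  type is polymorphic so as to cover both \<open>\<mu>\<close> (complex) and \<open>measure (total_variation \<mu>)\<close> (real).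
\<close>

definition has_radon_derivative ::
    "(complex set \<Rightarrow> 'a :: real_normed_vector) \<Rightarrow> 'a \<Rightarrow> complex \<Rightarrow> bool" where
  "has_radon_derivative \<nu> L w \<longleftrightarrow>
     ((\<lambda>r. \<nu> (ball w r) /\<^sub>R measure lebesgue (ball w r)) \<longlongrightarrow> L) (at_right 0)"

definition density_point :: "complex set \<Rightarrow> complex \<Rightarrow> bool" where
  "density_point E w \<longleftrightarrow>
     ((\<lambda>r. measure lebesgue (E \<inter> ball w r) / measure lebesgue (ball w r)) \<longlongrightarrow> 1) (at_right 0)"

end

theory Submission
  imports Defs "HOL-Complex_Analysis.Cauchy_Integral_Formula"
begin

text \<open>
  On the disc \<open>B(w,r)\<close> the function \<open>z - w\<close> is a multiple of the Cauchy-Riemann derivative of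
  \<open>\<phi>\<^sub>r(\<zeta>) = max 0 (r\<^sup>2 - |\<zeta> - w|\<^sup>2)\<close>. By Fubini, \<open>\<pi> \<integral> \<phi>\<^sub>r d\<mu>\<close> is therefore, up to sign, the integral of
  \<open>(z - w) C\<^sup>\<mu>(z)\<close> over \<open>B(w,r)\<close>, and only the small set \<open>F = B(w,r) - E\<close> contributes to it.
  For \<open>z \<in> F\<close> and two points \<open>z\<^sub>0, z\<^sub>1\<close> of \<open>G = B(w,r) \<inter> E\<close>, the vanishing of \<open>C\<^sup>\<mu>\<close> at
  \<open>z\<^sub>0\<close> and \<open>z\<^sub>1\<close> gives
  \<open>C\<^sup>\<mu>(z) = (z - z\<^sub>0) (z - z\<^sub>1) \<integral> d\<mu>(\<zeta>) / ((\<zeta> - z) (\<zeta> - z\<^sub>0) (\<zeta> - z\<^sub>1))\<close>.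
  Averaging over \<open>z\<^sub>0\<close> and \<open>z\<^sub>1\<close> and using \<open>|\<mu>|(B(w,s)) \<le> M s\<^sup>2\<close> yields \<open>\<integral> \<phi>\<^sub>r d\<mu> = o(r\<^sup>4)\<close>.
  Finally \<open>\<phi>\<^sub>r - \<phi>\<^bsub>ar\<^esub>\<close> is constant on \<open>B(w,ar)\<close> and vanishes outside \<open>B(w,r)\<close>, and the
  annulus between them has small \<open>|\<mu>|\<close>-measure compared with \<open>r\<^sup>2\<close> when \<open>a\<close> is close to 1.
\<close>

section \<open>The Lebesgue measure of the plane and the Cauchy kernel\<close>

text \<open>The indicator of a disc is not a usable test function: its Cauchy-Riemann derivative
  lives on a circle, which has no area, while density of E controls area only. The truncated
  paraboloid has a derivative of size at most r spread over the disc. Two zeros are used because of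
  the far field. At distance about 2^k r from w the mass of |\<mu>| may be of order M 4^k r^2.
  Subtracting one zero leaves a kernel decaying like 4^-k, so all dyadic rings could contribute
  equally and the bound would diverge; two zeros give 8^-k and a geometric series. For fixed poles
  the resulting kernel is still singular. Averaging every pole over a set of positive area turns
  each factor into a bounded potential, and the potential of F carries the smallness: the area
  integral of 1 / |\<zeta> - z| over F is at most of the order of the square root of the area of F.
  Principal values matter only at the zeros: for almost every z the kernel is absolutely integrable
  against |\<mu>|, and there the principal value is an ordinary integral.\<close>

lemma emeasure_open_orthogonal_image_ge:
  fixes f :: "'a::euclidean_space \<Rightarrow> 'a"
  assumes f: "orthogonal_transformation f" and U: "open U"
  shows "emeasure lborel U \<le> emeasure lborel (f ` U)"
proof -
  \<comment> \<open>Vitali covering: up to a null set, \<open>U\<close> is a countable disjoint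
    union of balls inside \<open>U\<close>. The map sends each of them to a ball of the same radius,
    hence of the same volume, and the images stay disjoint.\<close>
  define K where "K = {p. snd p > 0 \<and> ball (fst p) (snd p) \<subseteq> U}"
  have "\<exists>p. p \<in> K \<and> x \<in> ball (fst p) (snd p) \<and> snd p < d" if "x \<in> U" "0 < d" for x :: 'a and d
  proof -
    obtain e where e: "e > 0" "ball x e \<subseteq> U"
      using U \<open>x \<in> U\<close> by (meson openE)
    have "ball x (min e (d/2)) \<subseteq> U"
      using e by auto
    then show ?thesis
      using e that by (intro exI[of _ "(x, min e (d/2))"]) (auto simp: K_def)
  qed
  then obtain C where C: "countable C" "C \<subseteq> K"
    and disj: "pairwise (\<lambda>i j. disjnt (ball (fst i) (snd i)) (ball (fst j) (snd j))) C"
    and neg: "negligible (U - (\<Union>i\<in>C. ball (fst i) (snd i)))"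
    by (rule Vitali_covering_theorem_balls[of U K fst snd])
  let ?V = "\<Union>i\<in>C. ball (fst i) (snd i)"
  have V[measurable]: "?V \<in> sets borel" "open ?V" and [measurable]: "U \<in> sets borel"
    using U by (auto intro!: borel_open)
  have null: "U - ?V \<in> null_sets lborel"
    using neg by (subst null_sets_completion_iff[symmetric])
      (auto simp: negligible_iff_null_sets)
  have inj: "inj f" and lin: "linear f" and sf: "surj f"
    using f orthogonal_transformation_inj orthogonal_transformation_linear
      orthogonal_transformation_surj by blast+
  have im: "f ` ball x r = ball (f x) r" for x r
    by (rule image_orthogonal_transformation_ball[OF f])
  have d1: "disjoint_family_on (\<lambda>i. ball (fst i) (snd i)) C"
    using disj by (auto simp: disjoint_family_on_def pairwise_def disjnt_def)
  have d2: "disjoint_family_on (\<lambda>i. ball (f (fst i)) (snd i)) C"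
    unfolding disjoint_family_on_def
  proof (intro ballI impI)
    fix i j assume ij: "i \<in> C" "j \<in> C" "i \<noteq> j"
    then have "ball (fst i) (snd i) \<inter> ball (fst j) (snd j) = {}"
      using d1 by (auto simp: disjoint_family_on_def)
    then show "ball (f (fst i)) (snd i) \<inter> ball (f (fst j)) (snd j) = {}"
      unfolding im[symmetric] image_Int[OF inj, symmetric] by simp
  qed
  have "U \<subseteq> ?V \<union> (U - ?V)" by blast
  then have "emeasure lborel U \<le> emeasure lborel (?V \<union> (U - ?V))"
    by (intro emeasure_mono) auto
  also have "\<dots> = emeasure lborel ?V"
    using null by (intro emeasure_Un_null_set) auto
  also have "\<dots> = (\<integral>\<^sup>+i. emeasure lborel (ball (fst i) (snd i)) \<partial>count_space C)"
    using C d1 by (intro emeasure_UN_countable) auto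
  also have "\<dots> = (\<integral>\<^sup>+i. emeasure lborel (ball (f (fst i)) (snd i)) \<partial>count_space C)"
    using C(2) by (intro nn_integral_cong) (auto simp: K_def emeasure_ball)
  also have "\<dots> = emeasure lborel (\<Union>i\<in>C. ball (f (fst i)) (snd i))"
    using C d2 by (intro emeasure_UN_countable[symmetric]) auto
  also have "(\<Union>i\<in>C. ball (f (fst i)) (snd i)) = f ` ?V"
    by (simp add: image_UN im)
  also have "emeasure lborel (f ` ?V) \<le> emeasure lborel (f ` U)"
  proof (rule emeasure_mono)
    show "f ` ?V \<subseteq> f ` U"
      using C(2) by (intro image_mono) (auto simp: K_def)
    show "f ` U \<in> sets lborel"
      using open_surjective_linear_image[OF U lin sf] by auto
  qed
  finally show ?thesis .
qed

lemma lborel_distr_orthogonal: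
  fixes f :: "'a::euclidean_space \<Rightarrow> 'a"
  assumes f: "orthogonal_transformation f"
  shows "distr lborel borel f = lborel"
proof (rule lborel_eqI[symmetric])
  have bij: "bij f" and lin: "linear f"
    using f orthogonal_transformation_bij orthogonal_transformation_linear by blast+
  have cont: "continuous_on UNIV f"
    using lin by (simp add: linear_continuous_on linear_linear)
  then have [measurable]: "f \<in> borel_measurable borel"
    by (rule borel_measurable_continuous_onI)
  fix l u :: 'a assume lu: "\<And>b. b \<in> Basis \<Longrightarrow> l \<bullet> b \<le> u \<bullet> b"
  have op: "open (f -` box l u)"
    using cont by (simp add: continuous_on_open_vimage open_box)
  have "emeasure (distr lborel borel f) (box l u) = emeasure lborel (f -` box l u)"
    by (subst emeasure_distr) auto
  also have "\<dots> = emeasure lborel (box l u)"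
  \<comment> \<open>The box and its preimage are images of one another under \<open>f\<close> and
    its inverse, so the one-sided estimate for both maps gives equality.\<close>
  proof (rule antisym)
    show "emeasure lborel (f -` box l u) \<le> emeasure lborel (box l u)"
      using emeasure_open_orthogonal_image_ge[OF f op] bij
      by (simp add: bij_is_surj image_vimage_eq)
    show "emeasure lborel (box l u) \<le> emeasure lborel (f -` box l u)"
      using emeasure_open_orthogonal_image_ge[OF orthogonal_transformation_inv[OF f] open_box, of l u]
      by (simp add: bij_vimage_eq_inv_image[OF bij])
  qed
  finally show "emeasure (distr lborel borel f) (box l u) = (\<Prod>b\<in>Basis. (u - l) \<bullet> b)"
    using lu by (simp add: emeasure_lborel_box_eq)
qed simp

section \<open>Area integrals of the Cauchy kernel\<close>

text \<open>Infinite on the diagonal, whereas the complex quotient 1 / (\<zeta> - z) is 0 there by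
  convention. A finite integral of the kernel therefore excludes mass at the pole.\<close>

definition cauchy_kernel :: "complex \<Rightarrow> complex \<Rightarrow> ennreal" where
  "cauchy_kernel \<zeta> z = inverse (ennreal (norm (\<zeta> - z)))"

lemma borel_measurable_cauchy_kernel [measurable]: "cauchy_kernel \<zeta> \<in> borel_measurable borel"
proof -
  have "(\<lambda>z. cauchy_kernel \<zeta> z) \<in> borel_measurable borel"
    unfolding cauchy_kernel_def by measurable
  then show ?thesis .
qed

lemma measurable_cauchy_kernel [measurable (raw)]:
  assumes [measurable]: "f \<in> borel_measurable M" "g \<in> borel_measurable M"
  shows "(\<lambda>x. cauchy_kernel (f x) (g x)) \<in> borel_measurable M"
  unfolding cauchy_kernel_def by measurable

lemma cauchy_kernel_le:
  assumes "0 < d" "d \<le> norm (\<zeta> - z)"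
  shows "cauchy_kernel \<zeta> z \<le> ennreal (1 / d)"
proof -
  have "cauchy_kernel \<zeta> z = ennreal (1 / norm (\<zeta> - z))"
    using assms unfolding cauchy_kernel_def by (subst inverse_ennreal) (auto simp: inverse_eq_divide)
  also have "\<dots> \<le> ennreal (1 / d)"
    using assms by (intro ennreal_leI frac_le) auto
  finally show ?thesis .
qed

lemma ennreal_norm_inverse_le_cauchy_kernel:
  "ennreal (norm (1 / (\<zeta> - z))) \<le> cauchy_kernel \<zeta> z"
  unfolding cauchy_kernel_def
  by (cases "\<zeta> = z") (auto simp: inverse_ennreal norm_divide inverse_eq_divide)

lemma ball_borel_measurable [measurable]: "ball (w::'a::metric_space) r \<in> sets borel"
  by simp

lemma emeasure_ball_complex:
  "r \<ge> 0 \<Longrightarrow> emeasure lborel (ball (w::complex) r) = ennreal (pi * r\<^sup>2)"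
  by (simp add: emeasure_ball unit_ball_vol_2)

lemma measure_ball_complex:
  "r \<ge> 0 \<Longrightarrow> measure lborel (ball (w::complex) r) = pi * r\<^sup>2"
  by (simp add: content_ball unit_ball_vol_2)

lemma ennreal_le_suminf: "f n \<le> (\<Sum>n. f n :: ennreal)"
  using sum_le_suminf[of f "{n}"] by simp

text \<open>Dyadic rings: where the distance is between \<delta> / 2^(n+1) and \<delta> / 2^n the
  kernel is at most 2^(n+1) / \<delta>, and the enclosing disc has area pi \<delta>^2 / 4^n, so ring
  n contributes at most 2 pi \<delta> / 2^n. The exact value is 2 pi \<delta>; the lost factor 2 is
  harmless.\<close>

lemma nn_integral_cauchy_kernel_ball:
  assumes \<delta>: "\<delta> > 0"
  shows "(\<integral>\<^sup>+z. cauchy_kernel \<zeta> z * indicator (ball \<zeta> \<delta>) z \<partial>lborel) \<le> ennreal (4 * pi * \<delta>)"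
proof -
  have "(\<integral>\<^sup>+z. cauchy_kernel \<zeta> z * indicator (ball \<zeta> \<delta>) z \<partial>lborel)
      \<le> (\<integral>\<^sup>+z. (\<Sum>n. ennreal (2 ^ Suc n / \<delta>) * indicator (ball \<zeta> (\<delta> / 2 ^ n)) z) \<partial>lborel)"
  proof (rule nn_integral_mono_AE)
    show "AE z in lborel. cauchy_kernel \<zeta> z * indicator (ball \<zeta> \<delta>) z
        \<le> (\<Sum>n. ennreal (2 ^ Suc n / \<delta>) * indicator (ball \<zeta> (\<delta> / 2 ^ n)) z)"
      using AE_lborel_singleton[of \<zeta>]
    proof eventually_elim
      case (elim z)
      show ?case
      proof (cases "z \<in> ball \<zeta> \<delta>")
        case True
        define d where "d = norm (\<zeta> - z)"
        have d: "0 < d" "d < \<delta>" using elim True by (auto simp: d_def dist_norm)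
        have "\<exists>n. \<delta> / 2 ^ Suc n \<le> d"
        proof -
          obtain n where "(1/2) ^ n < d / \<delta>"
            using real_arch_pow_inv[of "d/\<delta>" "1/2"] d \<delta> by auto
          then have "\<delta> / 2 ^ n < d" using \<delta> by (simp add: field_simps power_divide)
          then show ?thesis using \<delta> by (intro exI[of _ n]) (auto simp: field_simps)
        qed
        define n where "n = (LEAST n. \<delta> / 2 ^ Suc n \<le> d)"
        have n1: "\<delta> / 2 ^ Suc n \<le> d"
          unfolding n_def by (rule LeastI_ex) fact
        have n2: "d < \<delta> / 2 ^ n"
        proof (cases n)
          case (Suc m)
          then have "m < (LEAST n. \<delta> / 2 ^ Suc n \<le> d)" by (simp add: n_def)
          from not_less_Least[OF this] show ?thesis using Suc by simp
        qed (use d in auto)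
        have "cauchy_kernel \<zeta> z \<le> ennreal (1 / (\<delta> / 2 ^ Suc n))"
          using n1 \<delta> by (intro cauchy_kernel_le) (auto simp: d_def)
        also have "\<dots> = ennreal (2 ^ Suc n / \<delta>) * indicator (ball \<zeta> (\<delta> / 2 ^ n)) z"
          using n2 by (simp add: d_def dist_norm)
        also have "\<dots> \<le> (\<Sum>n. ennreal (2 ^ Suc n / \<delta>) * indicator (ball \<zeta> (\<delta> / 2 ^ n)) z)"
          by (rule ennreal_le_suminf)
        finally show ?thesis using True by simp
      qed simp
    qed
  qed
  also have "\<dots> = (\<Sum>n. ennreal (2 ^ Suc n / \<delta>) * emeasure lborel (ball \<zeta> (\<delta> / 2 ^ n)))"
    by (subst nn_integral_suminf) (auto simp: nn_integral_cmult)
  also have "\<dots> = (\<Sum>n. ennreal (2 * pi * \<delta> * (1/2) ^ n))"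
    using \<delta> by (intro suminf_cong)
      (simp add: emeasure_ball_complex ennreal_mult[symmetric] power_divide field_simps power2_eq_square)
  also have "\<dots> = ennreal (2 * pi * \<delta> * 2)"
  proof -
    have "(\<lambda>n. 2 * pi * \<delta> * (1/2) ^ n) sums (2 * pi * \<delta> * 2)"
      using geometric_sums[of "1/2::real"] by (intro sums_mult) simp
    then show ?thesis using \<delta> by (subst suminf_ennreal_eq) auto
  qed
  finally show ?thesis by (simp add: mult_ac)
qed

text \<open>Outside the disc of radius \<delta> about \<zeta> the kernel is at most 1 / \<delta>.
  The radius is left free so that it can be matched to the square root of the area of
  \<open>S\<close>.\<close>

lemma nn_integral_cauchy_kernel_le:
  assumes [measurable]: "S \<in> sets borel" and \<delta>: "\<delta> > 0"
  shows "(\<integral>\<^sup>+z. cauchy_kernel \<zeta> z * indicator S z \<partial>lborel)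
      \<le> ennreal (1 / \<delta>) * emeasure lborel S + ennreal (4 * pi * \<delta>)"
proof -
  have "(\<integral>\<^sup>+z. cauchy_kernel \<zeta> z * indicator S z \<partial>lborel)
      \<le> (\<integral>\<^sup>+z. ennreal (1 / \<delta>) * indicator S z + cauchy_kernel \<zeta> z * indicator (ball \<zeta> \<delta>) z \<partial>lborel)"
    using \<delta> by (intro nn_integral_mono)
      (auto simp: indicator_def dist_norm not_less intro!: cauchy_kernel_le)
  also have "\<dots> = ennreal (1 / \<delta>) * emeasure lborel S + (\<integral>\<^sup>+z. cauchy_kernel \<zeta> z * indicator (ball \<zeta> \<delta>) z \<partial>lborel)"
    by (subst nn_integral_add, (measurable)[2], subst nn_integral_cmult_indicator) (simp_all add: assms(1))
  also have "\<dots> \<le> ennreal (1 / \<delta>) * emeasure lborel S + ennreal (4 * pi * \<delta>)"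
    using nn_integral_cauchy_kernel_ball[OF \<delta>] by (intro add_left_mono)
  finally show ?thesis .
qed

section \<open>The Cauchy-Pompeiu formula on a disc\<close>

lemma circle_average_cauchy_kernel:
  assumes "norm z \<noteq> norm \<zeta>"
  shows "(\<integral>t. indicator {0..1} t *\<^sub>R
            (exp (2 * of_real pi * \<i> * of_real t) * z / (\<zeta> - exp (2 * of_real pi * \<i> * of_real t) * z)) \<partial>lborel)
         = (if norm z < norm \<zeta> then 0 else -1)" (is "(\<integral>t. indicator {0..1} t *\<^sub>R ?f t \<partial>lborel) = ?R")
proof (cases "z = 0")
  case True
  then show ?thesis using assms by simp
next
  case False
  have ne: "\<zeta> - exp (2 * of_real pi * \<i> * of_real t) * z \<noteq> 0" for t :: real
  proof
    assume "\<zeta> - exp (2 * of_real pi * \<i> * of_real t) * z = 0"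
    then have "norm \<zeta> = norm (exp (2 * of_real pi * \<i> * of_real t)) * norm z"
      by (metis eq_iff_diff_eq_0 norm_mult)
    then show False using assms by simp
  qed
  have "set_integrable lborel {0..1} ?f"
    using ne by (intro borel_integrable_atLeastAtMost' continuous_intros) auto
  then have eq: "(\<integral>t. indicator {0..1} t *\<^sub>R ?f t \<partial>lborel) = integral {0..1} ?f"
    using set_borel_integral_eq_integral(2) by (fastforce simp: set_lebesgue_integral_def)
  have key: "((\<lambda>u. 1 / (u - \<zeta> / z)) has_contour_integral (if norm z < norm \<zeta> then 0 else 2 * of_real pi * \<i>))
          (circlepath 0 1)"
  proof (cases "norm z < norm \<zeta>")
    case True
    have "((\<lambda>u. 1 / (u - \<zeta> / z)) has_contour_integral 0) (circlepath 0 1)"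
    proof (rule Cauchy_theorem_disc_simple[of _ 0 "norm (\<zeta> / z)"])
      show "(\<lambda>u. 1 / (u - \<zeta> / z)) holomorphic_on ball 0 (cmod (\<zeta> / z))"
        by (intro holomorphic_intros) auto
      show "path_image (circlepath 0 1) \<subseteq> ball 0 (cmod (\<zeta> / z))"
        using True False by (auto simp: norm_divide field_simps)
    qed auto
    then show ?thesis using True by simp
  next
    case F: False
    then have "norm (\<zeta> / z - 0) < 1"
      using assms False by (simp add: norm_divide field_simps)
    from Cauchy_integral_circlepath_simple[of "\<lambda>_. 1", OF _ this]
    show ?thesis using F by simp
  qed
  \<comment> \<open>With u = exp (2 pi i t) the integrand of the claim is -u / (u - \<zeta> / z).
    Its average over t is minus the winding number of the unit circle about \<zeta> / z.\<close>
  have "((\<lambda>t. - (1 / (2 * of_real pi * \<i>)) * (1 / (circlepath 0 1 t - \<zeta> / z) * vector_derivative (circlepath 0 1) (at t within {0..1})))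
     has_integral - (1 / (2 * of_real pi * \<i>)) * (if norm z < norm \<zeta> then 0 else 2 * of_real pi * \<i>)) {0..1}"
    using key unfolding has_contour_integral_def by (rule has_integral_mult_right)
  also have "- (1 / (2 * of_real pi * \<i>)) * (if norm z < norm \<zeta> then 0 else 2 * of_real pi * \<i>) = ?R"
    by simp
  finally have "(?f has_integral ?R) {0..1}"
  proof (rule has_integral_eq[rotated])
    fix t :: real assume t: "t \<in> {0..1}"
    define e where "e = exp (2 * of_real pi * \<i> * of_real t)"
    have "\<zeta> - e * z \<noteq> 0" using ne[of t] by (simp add: e_def)
    then have "e - \<zeta> / z \<noteq> 0" using False by (auto simp: field_simps)
    have "- (1 / (2 * of_real pi * \<i>)) * (1 / (e - \<zeta> / z) * (2 * of_real pi * \<i> * e)) = e * z / (\<zeta> - e * z)"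
      using \<open>\<zeta> - e * z \<noteq> 0\<close> \<open>e - \<zeta> / z \<noteq> 0\<close> False by (simp add: divide_simps) (simp add: algebra_simps)
    then show "- (1 / (2 * of_real pi * \<i>)) * (1 / (circlepath 0 1 t - \<zeta> / z) * vector_derivative (circlepath 0 1) (at t within {0..1})) = ?f t"
      using t by (simp add: vector_derivative_circlepath01 e_def[symmetric]) (simp add: circlepath e_def)
  qed
  then show ?thesis using eq by (simp add: integral_unique)
qed

lemma integrable_disc_cauchy_kernel:
  fixes \<zeta> w :: complex
  assumes r: "r > 0"
  shows "integrable lborel (\<lambda>z. indicator (ball w r) z *\<^sub>R ((z - w) / (\<zeta> - z)))"
proof (rule integrableI_bounded)
  have "(\<integral>\<^sup>+z. ennreal (norm (indicator (ball w r) z *\<^sub>R ((z - w) / (\<zeta> - z)))) \<partial>lborel)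
      \<le> (\<integral>\<^sup>+z. ennreal r * (cauchy_kernel \<zeta> z * indicator (ball w r) z) \<partial>lborel)"
  proof (rule nn_integral_mono)
    fix z
    show "ennreal (norm (indicator (ball w r) z *\<^sub>R ((z - w) / (\<zeta> - z))))
        \<le> ennreal r * (cauchy_kernel \<zeta> z * indicator (ball w r) z)"
    proof (cases "z \<in> ball w r")
      case True
      have "norm ((z - w) / (\<zeta> - z)) = norm (z - w) * norm (1 / (\<zeta> - z))"
        by (simp add: norm_divide)
      then have "ennreal (norm ((z - w) / (\<zeta> - z))) = ennreal (norm (z - w)) * ennreal (norm (1 / (\<zeta> - z)))"
        by (simp add: ennreal_mult)
      also have "\<dots> \<le> ennreal r * cauchy_kernel \<zeta> z"
        using True by (intro mult_mono ennreal_norm_inverse_le_cauchy_kernel ennreal_leI)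
          (auto simp: dist_norm norm_minus_commute)
      finally show ?thesis using True by simp
    qed simp
  qed
  also have "\<dots> = ennreal r * (\<integral>\<^sup>+z. cauchy_kernel \<zeta> z * indicator (ball w r) z \<partial>lborel)"
    by (rule nn_integral_cmult) measurable
  also have "\<dots> \<le> ennreal r * (ennreal (1 / r) * emeasure lborel (ball w r) + ennreal (4 * pi * r))"
    using r by (intro mult_left_mono nn_integral_cauchy_kernel_le) auto
  also have "\<dots> < \<infinity>"
    using r by (simp add: emeasure_ball_complex ennreal_mult[symmetric] ennreal_plus[symmetric] del: ennreal_plus)
  finally show "(\<integral>\<^sup>+z. ennreal (norm (indicator (ball w r) z *\<^sub>R ((z - w) / (\<zeta> - z)))) \<partial>lborel) < \<infinity>" .
qed measurable

lemma orthogonal_transformation_mult_unit: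
  "norm u = 1 \<Longrightarrow> orthogonal_transformation ((*) (u::complex))"
  unfolding orthogonal_transformation by (auto simp: norm_mult intro!: linearI simp: algebra_simps)

text \<open>Averaging over rotations takes the place of polar coordinates. Rotating the variable
  does not change the integral over the plane; after Fubini the average over the angle is -1 on the
  part of the disc farther from 0 than \<zeta> and 0 on the part nearer, so only the area of a ring
  remains.\<close>

lemma integral_disc_cauchy_kernel_centered:
  fixes \<zeta> w :: complex
  assumes r: "r > 0"
  shows "(\<integral>z. indicator (ball 0 r) z *\<^sub>R (z / (\<zeta> - z)) \<partial>lborel)
       = - complex_of_real (pi * max 0 (r\<^sup>2 - (norm \<zeta>)\<^sup>2))"
proof -
  define h where "h z = indicator (ball 0 r) z *\<^sub>R (z / (\<zeta> - z))" for z :: complex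
  define e where "e t = exp (2 * complex_of_real pi * \<i> * complex_of_real t)" for t :: real
  have ne: "norm (e t) = 1" for t by (simp add: e_def)
  have hi: "integrable lborel h"
    unfolding h_def using integrable_disc_cauchy_kernel[OF r, of 0] by simp
  have [measurable]: "h \<in> borel_measurable borel" unfolding h_def by measurable
  have [measurable]: "e \<in> borel_measurable borel"
    unfolding e_def by (intro borel_measurable_continuous_onI continuous_intros)
  have rot: "distr lborel borel ((*) (e t)) = lborel" for t
    by (intro lborel_distr_orthogonal orthogonal_transformation_mult_unit ne)
  have rot_int: "(\<integral>z. g (e t * z) \<partial>lborel) = (\<integral>z. g z \<partial>lborel)"
    if [measurable]: "g \<in> borel_measurable borel" for g :: "complex \<Rightarrow> 'b::{banach,second_countable_topology}" and t
    using integral_distr[of "(*) (e t)" lborel borel g] rot[of t] by simp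
  have rot_integrable: "integrable lborel (\<lambda>z. h (e t * z))" for t
    using integrable_distr_eq[of "(*) (e t)" lborel borel h] rot[of t] hi by simp
  have int: "integrable (lborel \<Otimes>\<^sub>M lborel) (\<lambda>(t, z). indicator {0..1} t *\<^sub>R h (e t * z))"
  proof (rule lborel_pair.Fubini_integrable)
    have "integrable lborel (\<lambda>t::real. indicator {0..1} t * (\<integral>z. norm (h z) \<partial>lborel))"
      by (intro integrable_mult_left integrable_real_indicator) auto
    moreover have "(\<integral>z. norm (indicator {0..1} t *\<^sub>R h (e t * z)) \<partial>lborel)
        = indicator {0..1} t * (\<integral>z. norm (h z) \<partial>lborel)" for t :: real
      using rot_int[of "\<lambda>z. norm (h z)" t] by simp
    ultimately show "integrable lborel (\<lambda>x. LINT y|lborel. norm (case (x, y) of (t, z) \<Rightarrow> indicat_real {0..1} t *\<^sub>R h (e t * z)))"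
      by (simp del: norm_scaleR)
    show "AE x in lborel. integrable lborel (\<lambda>y. case (x, y) of (t, z) \<Rightarrow> indicat_real {0..1} t *\<^sub>R h (e t * z))"
      using rot_integrable by simp
  qed measurable
  have "(\<integral>z. h z \<partial>lborel) = (\<integral>t. indicator {0..1::real} t *\<^sub>R (\<integral>z. h z \<partial>lborel) \<partial>lborel)"
    by simp
  also have "\<dots> = (\<integral>t. (\<integral>z. indicator {0..1} t *\<^sub>R h (e t * z) \<partial>lborel) \<partial>lborel)"
    using rot_int[of h] by simp
  also have "\<dots> = (\<integral>z. (\<integral>t. indicator {0..1} t *\<^sub>R h (e t * z) \<partial>lborel) \<partial>lborel)"
    using int by (rule lborel_pair.Fubini_integral[symmetric])
  also have "\<dots> = (\<integral>z. - complex_of_real (indicator (ball 0 r - ball 0 (norm \<zeta>)) (z::complex)) \<partial>lborel)"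
  proof (rule Bochner_Integration.integral_cong_AE)
    \<comment> \<open>On this circle the rotated point runs into the pole \<zeta>.\<close>
    have "sphere 0 (norm \<zeta>) \<in> null_sets (lborel :: complex measure)"
      using negligible_sphere[of "0::complex" "norm \<zeta>"]
      by (subst null_sets_completion_iff[symmetric]) (auto simp: negligible_iff_null_sets borel_closed)
    from AE_not_in[OF this]
    show "AE z in lborel. (\<integral>t. indicator {0..1} t *\<^sub>R h (e t * z) \<partial>lborel)
        = - complex_of_real (indicator (ball 0 r - ball 0 (norm \<zeta>)) z)"
    proof eventually_elim
      case (elim z)
      have "(\<integral>t. indicator {0..1} t *\<^sub>R h (e t * z) \<partial>lborel)
          = (\<integral>t. indicator (ball 0 r) z *\<^sub>R (indicator {0..1} t *\<^sub>R (e t * z / (\<zeta> - e t * z))) \<partial>lborel)"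
        by (intro Bochner_Integration.integral_cong refl)
          (auto simp: h_def indicator_def norm_mult ne)
      also have "\<dots> = indicator (ball 0 r) z *\<^sub>R (if norm z < norm \<zeta> then 0 else -1)"
        using elim circle_average_cauchy_kernel[of z \<zeta>] by (subst integral_scaleR_right) (simp add: e_def)
      finally show ?case by (auto simp: indicator_def)
    qed
  qed measurable
  also have "\<dots> = - complex_of_real (measure lborel (ball 0 r - ball 0 (norm \<zeta>) :: complex set))"
    by simp
  also have "measure lborel (ball 0 r - ball 0 (norm \<zeta>) :: complex set) = pi * max 0 (r\<^sup>2 - (norm \<zeta>)\<^sup>2)"
  proof (cases "norm \<zeta> \<le> r")
    case True
    then have sub: "ball 0 (norm \<zeta>) \<subseteq> (ball 0 r :: complex set)" by auto
    have "measure lborel (ball 0 r - ball 0 (norm \<zeta>) :: complex set)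
        = measure lborel (ball 0 r :: complex set) - measure lborel (ball 0 (norm \<zeta>) :: complex set)"
      using sub r by (intro measure_Diff) (auto simp: emeasure_ball_complex)
    also have "\<dots> = pi * (r\<^sup>2 - (norm \<zeta>)\<^sup>2)"
      using measure_ball_complex[of r 0] measure_ball_complex[of "norm \<zeta>" 0] r
      by (simp add: algebra_simps)
    finally show ?thesis
      using True r by (simp add: power_mono max_def)
  next
    case False
    then have "ball 0 r - ball 0 (norm \<zeta>) = ({} :: complex set)" by auto
    moreover have "r\<^sup>2 \<le> (norm \<zeta>)\<^sup>2" using False r by (intro power_mono) auto
    ultimately show ?thesis by (simp only: measure_empty) simp
  qed
  finally show ?thesis unfolding h_def .
qed

text \<open>
  The function \<open>z - w\<close> on the disc is, up to a constant factor, the Cauchy-Riemann derivative of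
  the function \<open>max 0 (r\<^sup>2 - (norm (\<zeta> - w))\<^sup>2)\<close>; this is an instance of the Cauchy-Pompeiu formula.
\<close>
lemma integral_disc_cauchy_kernel:
  fixes \<zeta> w :: complex
  assumes r: "r > 0"
  shows "(\<integral>z. indicator (ball w r) z *\<^sub>R ((z - w) / (\<zeta> - z)) \<partial>lborel)
       = - complex_of_real (pi * max 0 (r\<^sup>2 - (norm (\<zeta> - w))\<^sup>2))"
proof -
  have "(\<integral>z. indicator (ball w r) z *\<^sub>R ((z - w) / (\<zeta> - z)) \<partial>lborel)
      = (\<integral>z. indicator (ball w r) z *\<^sub>R ((z - w) / (\<zeta> - z)) \<partial>distr lborel borel ((+) w))"
    by (simp add: lborel_distr_plus)
  also have "\<dots> = (\<integral>z. indicator (ball w r) (w + z) *\<^sub>R (((w + z) - w) / (\<zeta> - (w + z))) \<partial>lborel)"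
    by (subst integral_distr) auto
  also have "\<dots> = (\<integral>z. indicator (ball 0 r) z *\<^sub>R (z / ((\<zeta> - w) - z)) \<partial>lborel)"
    by (intro Bochner_Integration.integral_cong refl) (auto simp: indicator_def dist_norm diff_diff_eq)
  finally show ?thesis
    using integral_disc_cauchy_kernel_centered[OF r, of "\<zeta> - w"] by simp
qed

section \<open>Complex measures and their total variation\<close>

lemma complex_measureD:
  assumes "complex_measure \<mu>" "range A \<subseteq> sets borel" "disjoint_family A"
  shows "(\<lambda>i. \<mu> (A i)) sums \<mu> (\<Union>i. A i)"
  using assms by (auto simp: complex_measure_def)

lemma complex_measure_empty:
  assumes "complex_measure \<mu>"
  shows "\<mu> {} = 0"
proof -
  have "(\<lambda>i::nat. \<mu> {}) sums \<mu> (\<Union>i::nat. {})"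
    by (rule complex_measureD[OF assms]) (auto simp: disjoint_family_on_def)
  then have "summable (\<lambda>i::nat. \<mu> {})" by (rule sums_summable)
  then show ?thesis by (simp add: summable_const_iff)
qed

lemma complex_measure_Un:
  assumes \<mu>: "complex_measure \<mu>" and AB: "A \<in> sets borel" "B \<in> sets borel" "A \<inter> B = {}"
  shows "\<mu> (A \<union> B) = \<mu> A + \<mu> B"
proof -
  have "(\<lambda>i. \<mu> (binaryset A B i)) sums \<mu> (\<Union>i. binaryset A B i)"
    using AB by (intro complex_measureD[OF \<mu>])
      (auto simp: range_binaryset_eq disjoint_family_on_def binaryset_def)
  moreover have "(\<lambda>i. \<mu> (binaryset A B i)) sums (\<mu> A + \<mu> B)"
    by (rule binaryset_sums) (rule complex_measure_empty[OF \<mu>])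
  ultimately show ?thesis
    by (simp add: UN_binaryset_eq sums_unique2)
qed

lemma complex_measure_Diff:
  assumes \<mu>: "complex_measure \<mu>" and AB: "A \<in> sets borel" "B \<in> sets borel" "A \<subseteq> B"
  shows "\<mu> (B - A) = \<mu> B - \<mu> A"
  using complex_measure_Un[OF \<mu> AB(1), of "B - A"] AB
  by (simp add: Un_absorb1 sets.Diff)

lemma complex_measure_UN:
  assumes \<mu>: "complex_measure \<mu>" and "finite I" and A: "\<And>i. i \<in> I \<Longrightarrow> A i \<in> sets borel"
    and "disjoint_family_on A I"
  shows "\<mu> (\<Union>i\<in>I. A i) = (\<Sum>i\<in>I. \<mu> (A i))"
  using assms(2-)
proof (induction I rule: finite_induct)
  case empty
  then show ?case using complex_measure_empty[OF \<mu>] by simp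
next
  case (insert x I)
  have "A x \<inter> (\<Union>i\<in>I. A i) = {}"
    using insert by (fastforce simp: disjoint_family_on_def)
  then have "\<mu> (A x \<union> (\<Union>i\<in>I. A i)) = \<mu> (A x) + \<mu> (\<Union>i\<in>I. A i)"
    using insert by (intro complex_measure_Un[OF \<mu>]) auto
  moreover have "\<mu> (\<Union>i\<in>I. A i) = (\<Sum>i\<in>I. \<mu> (A i))"
    using insert by (intro insert.IH) (auto simp: disjoint_family_on_def)
  ultimately show ?case using insert by simp
qed

text \<open>
  A set on which \<open>\<mu>\<close> is unbounded splits into two pieces on which the modulus of \<open>\<mu>\<close> exceeds 1,
  and \<open>\<mu>\<close> is unbounded on one of them; iterating produces disjoint sets whose \<open>\<mu>\<close>-values
  do not tend to 0.
\<close>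
lemma complex_measure_bounded:
  assumes \<mu>: "complex_measure \<mu>"
  shows "\<exists>K. \<forall>A\<in>sets borel. norm (\<mu> A) \<le> K"
proof -
  define unb where "unb A \<longleftrightarrow> (\<forall>K. \<exists>B\<in>sets borel. B \<subseteq> A \<and> norm (\<mu> B) > K)" for A
  have step: "\<exists>A'. (A' \<in> sets borel \<and> unb A') \<and> A' \<subseteq> A \<and> norm (\<mu> (A - A')) > 1"
    if A: "A \<in> sets borel" "unb A" for A
  proof -
    \<comment> \<open>The margin \<open>norm (\<mu> A) + 1\<close> makes the complement
      \<open>A - B\<close> large as well, by the triangle inequality.\<close>
    obtain B where B: "B \<in> sets borel" "B \<subseteq> A" "norm (\<mu> B) > norm (\<mu> A) + 1"
      using A(2) unfolding unb_def by blast
    have D: "norm (\<mu> (A - B)) > 1"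
      using complex_measure_Diff[OF \<mu> B(1) A(1) B(2)] norm_triangle_ineq2[of "\<mu> B" "\<mu> A"] B(3)
      by (simp add: norm_minus_commute)
    have "unb B \<or> unb (A - B)"
    proof (rule ccontr)
      assume "\<not> (unb B \<or> unb (A - B))"
      then obtain K1 K2 where K: "\<And>C. C \<in> sets borel \<Longrightarrow> C \<subseteq> B \<Longrightarrow> norm (\<mu> C) \<le> K1"
        "\<And>C. C \<in> sets borel \<Longrightarrow> C \<subseteq> A - B \<Longrightarrow> norm (\<mu> C) \<le> K2"
        unfolding unb_def by (meson not_le)
      obtain C where C: "C \<in> sets borel" "C \<subseteq> A" "norm (\<mu> C) > K1 + K2"
        using A(2) unfolding unb_def by blast
      have "\<mu> ((C \<inter> B) \<union> (C - B)) = \<mu> (C \<inter> B) + \<mu> (C - B)"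
        using B C by (intro complex_measure_Un[OF \<mu>]) auto
      moreover have "(C \<inter> B) \<union> (C - B) = C" by blast
      ultimately have "norm (\<mu> C) \<le> norm (\<mu> (C \<inter> B)) + norm (\<mu> (C - B))"
        using norm_triangle_ineq by metis
      moreover have "norm (\<mu> (C \<inter> B)) \<le> K1" "norm (\<mu> (C - B)) \<le> K2"
        using B C by (auto intro!: K)
      ultimately show False using C(3) by linarith
    qed
    then show ?thesis
    proof
      assume "unb B"
      then show ?thesis using B D by blast
    next
      assume "unb (A - B)"
      moreover have "A - (A - B) = B" using B(2) by blast
      ultimately show ?thesis
        using A B norm_ge_zero[of "\<mu> A"] by (intro exI[of _ "A - B"]) (auto simp del: norm_ge_zero)
    qed
  qed
  have "\<not> unb UNIV"
  proof
    assume "unb UNIV"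
    then have "\<exists>A::nat \<Rightarrow> complex set. \<forall>n. (A n \<in> sets borel \<and> unb (A n)) \<and> A (Suc n) \<subseteq> A n \<and> norm (\<mu> (A n - A (Suc n))) > 1"
      using step by (intro dependent_nat_choice) (auto intro!: exI[of _ UNIV])
    then obtain A :: "nat \<Rightarrow> complex set" where A: "\<And>n. A n \<in> sets borel"
      "\<And>n. A (Suc n) \<subseteq> A n" "\<And>n. norm (\<mu> (A n - A (Suc n))) > 1"
      by blast
    have anti: "A n \<subseteq> A m" if "m \<le> n" for m n
      using lift_Suc_antimono_le[of A, OF A(2) that] .
    have "disjoint_family (\<lambda>n. A n - A (Suc n))"
      unfolding disjoint_family_on_def
    proof (intro ballI impI)
      fix m n :: nat assume "m \<noteq> n"
      then consider "Suc m \<le> n" | "Suc n \<le> m" by linarith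
      then show "(A m - A (Suc m)) \<inter> (A n - A (Suc n)) = {}"
        using anti by cases blast+
    qed
    then have "(\<lambda>n. \<mu> (A n - A (Suc n))) sums \<mu> (\<Union>n. A n - A (Suc n))"
      using A by (intro complex_measureD[OF \<mu>]) auto
    then have "(\<lambda>n. \<mu> (A n - A (Suc n))) \<longlonglongrightarrow> 0"
      using sums_summable summable_LIMSEQ_zero by blast
    then have "\<forall>\<^sub>F n in sequentially. norm (\<mu> (A n - A (Suc n))) < 1"
      by (auto dest: tendstoD[of _ _ _ 1] simp: dist_norm)
    then obtain n where "norm (\<mu> (A n - A (Suc n))) < 1"
      using eventually_happens trivial_limit_sequentially by blast
    then show False using A(3)[of n] by simp
  qed
  then show ?thesis
    unfolding unb_def by (metis not_le subset_UNIV)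
qed

text \<open>Splitting into real and imaginary parts and then by sign leaves four subfamilies. Within
  each the terms have one sign, so their absolute sum is, up to sign, the real or imaginary part of
  \<mu> of a single union, hence at most \<open>K\<close>.\<close>

lemma sum_norm_complex_measure_le:
  assumes \<mu>: "complex_measure \<mu>" and K: "\<And>A. A \<in> sets borel \<Longrightarrow> norm (\<mu> A) \<le> K"
    and "finite I" and A: "\<And>i. i \<in> I \<Longrightarrow> A i \<in> sets borel" and disj: "disjoint_family_on A I"
  shows "(\<Sum>i\<in>I. norm (\<mu> (A i))) \<le> 4 * K"
proof -
  have half: "\<bar>\<Sum>i\<in>J. g (\<mu> (A i))\<bar> \<le> K"
    if "J \<subseteq> I" and g: "linear g" and gn: "\<And>z. \<bar>g z\<bar> \<le> norm z" for J and g :: "complex \<Rightarrow> real"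
  proof -
    have "(\<Sum>i\<in>J. g (\<mu> (A i))) = g (\<Sum>i\<in>J. \<mu> (A i))"
      using linear_sum[OF g] by (metis)
    also have "(\<Sum>i\<in>J. \<mu> (A i)) = \<mu> (\<Union>i\<in>J. A i)"
      using that(1) A finite_subset[OF that(1) \<open>finite I\<close>] disjoint_family_on_mono[OF that(1) disj]
      by (intro complex_measure_UN[OF \<mu>, symmetric]) auto
    finally have "\<bar>\<Sum>i\<in>J. g (\<mu> (A i))\<bar> \<le> norm (\<mu> (\<Union>i\<in>J. A i))" using gn by simp
    also have "\<dots> \<le> K"
      using that(1) A finite_subset[OF that(1) \<open>finite I\<close>] by (intro K sets.finite_UN) auto
    finally show ?thesis .
  qed
  have abs: "(\<Sum>i\<in>I. \<bar>g (\<mu> (A i))\<bar>) \<le> 2 * K"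
    if g: "linear g" and gn: "\<And>z. \<bar>g z\<bar> \<le> norm z" for g :: "complex \<Rightarrow> real"
  proof -
    define P where "P = {i\<in>I. g (\<mu> (A i)) \<ge> 0}"
    have "(\<Sum>i\<in>I. \<bar>g (\<mu> (A i))\<bar>) = (\<Sum>i\<in>I - P. \<bar>g (\<mu> (A i))\<bar>) + (\<Sum>i\<in>P. \<bar>g (\<mu> (A i))\<bar>)"
      using \<open>finite I\<close> by (intro sum.subset_diff) (auto simp: P_def)
    also have "\<dots> = - (\<Sum>i\<in>I - P. g (\<mu> (A i))) + (\<Sum>i\<in>P. g (\<mu> (A i)))"
      unfolding sum_negf[symmetric] by (intro arg_cong2[of _ _ _ _ "(+)"] sum.cong) (auto simp: P_def)
    also have "\<dots> \<le> K + K"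
      using half[OF _ g gn, of P] half[OF _ g gn, of "I - P"] by (auto simp: P_def)
    finally show ?thesis by simp
  qed
  have "(\<Sum>i\<in>I. norm (\<mu> (A i))) \<le> (\<Sum>i\<in>I. \<bar>Re (\<mu> (A i))\<bar> + \<bar>Im (\<mu> (A i))\<bar>)"
    by (intro sum_mono cmod_le)
  also have "\<dots> \<le> 2 * K + 2 * K"
    unfolding sum.distrib
    by (intro add_mono abs abs_Re_le_cmod abs_Im_le_cmod bounded_linear.linear bounded_linear_Re bounded_linear_Im)
  finally show ?thesis by simp
qed

text \<open>
  A nonzero value of the measure rules out the null measure as the result of \<open>measure_of\<close>.
\<close>
lemma emeasure_total_variation:
  assumes "measure (total_variation \<mu>) B \<noteq> 0" and A: "A \<in> sets borel"
  shows "emeasure (total_variation \<mu>) A = (SUP P \<in> {P :: nat \<Rightarrow> complex set.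
                     range P \<subseteq> sets borel \<and> disjoint_family P \<and> (\<Union>i. P i) = A}.
            \<Sum>i. ennreal (norm (\<mu> (P i))))"
proof -
  note sigma = sets.sigma_sets_eq[of "borel :: complex measure", simplified]
  have "emeasure (total_variation \<mu>) B \<noteq> 0"
    using assms(1) by (auto simp: measure_def)
  then have "measure_space UNIV (sets borel) (\<lambda>A. SUP P \<in> {P :: nat \<Rightarrow> complex set.
      range P \<subseteq> sets borel \<and> disjoint_family P \<and> (\<Union>i. P i) = A}. \<Sum>i. ennreal (norm (\<mu> (P i))))"
    unfolding total_variation_def emeasure_measure_of_conv sigma by meson
  then show ?thesis
    using A unfolding total_variation_def emeasure_measure_of_conv sigma by meson
qed

lemma sets_total_variation [simp, measurable_cong]: "sets (total_variation \<mu>) = sets borel"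
  unfolding total_variation_def using sets.sigma_sets_eq[of "borel :: complex measure"] by simp

lemma space_total_variation [simp]: "space (total_variation \<mu>) = UNIV"
  unfolding total_variation_def by simp

lemma finite_measure_total_variation:
  assumes \<mu>: "complex_measure \<mu>" and B: "measure (total_variation \<mu>) B \<noteq> 0"
  shows "finite_measure (total_variation \<mu>)"
proof (rule finite_measureI)
  obtain K where K: "\<And>A. A \<in> sets borel \<Longrightarrow> norm (\<mu> A) \<le> K"
    using complex_measure_bounded[OF \<mu>] by blast
  have UNIV: "UNIV \<in> sets (borel :: complex measure)" by simp
  have "emeasure (total_variation \<mu>) UNIV \<le> ennreal (4 * K)"
    unfolding emeasure_total_variation[OF B UNIV]
  proof (rule SUP_least, safe)
    fix P :: "nat \<Rightarrow> complex set"
    assume P: "range P \<subseteq> sets borel" "disjoint_family P"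
    have "(\<Sum>i<n. ennreal (norm (\<mu> (P i)))) \<le> ennreal (4 * K)" for n
      using P K by (subst sum_ennreal)
        (auto intro!: ennreal_leI sum_norm_complex_measure_le[OF \<mu>] simp: disjoint_family_on_def)
    then show "(\<Sum>i. ennreal (norm (\<mu> (P i)))) \<le> ennreal (4 * K)"
      by (intro suminf_le_const summableI) auto
  qed
  then show "emeasure (total_variation \<mu>) (space (total_variation \<mu>)) \<noteq> \<infinity>"
    by (auto simp: top_unique)
qed

text \<open>One admissible partition of \<open>A\<close> suffices: \<open>A\<close> itself followed
  by empty sets.\<close>

lemma norm_complex_measure_le_total_variation:
  assumes \<mu>: "complex_measure \<mu>" and B: "measure (total_variation \<mu>) B \<noteq> 0" and A: "A \<in> sets borel"
  shows "norm (\<mu> A) \<le> measure (total_variation \<mu>) A"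
proof -
  interpret finite_measure "total_variation \<mu>"
    by (rule finite_measure_total_variation[OF \<mu> B])
  have "ennreal (norm (\<mu> A)) \<le> (\<Sum>i. ennreal (norm (\<mu> (binaryset A {} i))))"
    using ennreal_le_suminf[of "\<lambda>i. ennreal (norm (\<mu> (binaryset A {} i)))" 0]
    by (simp add: binaryset_def)
  also have "\<dots> \<le> emeasure (total_variation \<mu>) A"
    unfolding emeasure_total_variation[OF B A]
    using A by (intro SUP_upper)
      (auto simp: UN_binaryset_eq range_binaryset_eq disjoint_family_on_def binaryset_def)
  finally show ?thesis by (simp add: emeasure_eq_measure)
qed

section \<open>Jordan decomposition\<close>

text \<open>The dominating measure \<open>T\<close> lies above both variations of \<nu>, so
  finiteness, integrability and null sets all pass from \<open>T\<close> to them.\<close>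

locale dominated_signed_measure = finite_measure T for T :: "complex measure" +
  fixes \<nu> :: "complex set \<Rightarrow> real"
  assumes sets_T [simp, measurable_cong]: "sets T = sets borel"
    and sums: "\<And>A :: nat \<Rightarrow> complex set. range A \<subseteq> sets borel \<Longrightarrow> disjoint_family A
      \<Longrightarrow> (\<lambda>i. \<nu> (A i)) sums \<nu> (\<Union>i. A i)"
    and bound: "\<And>A. A \<in> sets borel \<Longrightarrow> \<bar>\<nu> A\<bar> \<le> measure T A"
begin

lemma empty: "\<nu> {} = 0"
  using bound[of "{}"] by simp

lemma add: "A \<in> sets borel \<Longrightarrow> B \<in> sets borel \<Longrightarrow> A \<inter> B = {} \<Longrightarrow> \<nu> (A \<union> B) = \<nu> A + \<nu> B"
proof -
  assume AB: "A \<in> sets borel" "B \<in> sets borel" "A \<inter> B = {}"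
  have "(\<lambda>i. \<nu> (binaryset A B i)) sums \<nu> (\<Union>i. binaryset A B i)"
    using AB by (intro sums)
      (auto simp: range_binaryset_eq disjoint_family_on_def binaryset_def)
  moreover have "(\<lambda>i. \<nu> (binaryset A B i)) sums (\<nu> A + \<nu> B)"
    by (rule binaryset_sums) (rule empty)
  ultimately show ?thesis
    by (simp add: UN_binaryset_eq sums_unique2)
qed

lemma uminus: "dominated_signed_measure T (\<lambda>A. - \<nu> A)"
  using sums bound by unfold_locales (auto intro: sums_minus)

text \<open>Agrees with the supremum over Borel subsets of \<open>A\<close>, but here the index set
  does not depend on \<open>A\<close>. Suprema belonging to different sets can then be added and
  compared with a supremum of sums.\<close>

definition sup_on :: "complex set \<Rightarrow> ennreal" where
  "sup_on A = (SUP B\<in>sets borel. ennreal (\<nu> (B \<inter> A)))"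

text \<open>Borel sets chosen separately on the disjoint pieces can be glued into one. Gluing makes
  the competitors directed, which permits exchanging sum and supremum, and it allows a competitor to
  be emptied on the pieces where \<nu> is negative.\<close>

lemma sup_on_suminf:
  fixes A :: "nat \<Rightarrow> complex set"
  assumes A: "range A \<subseteq> sets borel" "disjoint_family A"
  shows "(\<Sum>i. sup_on (A i)) = sup_on (\<Union>i. A i)"
proof -
  have Ai: "A i \<in> sets borel" for i using A by auto
  have glue: "\<exists>B\<in>sets borel. \<forall>n. B \<inter> A n = C n \<inter> A n" if C: "\<And>n. C n \<in> sets borel" for C
  proof (intro bexI allI)
    have "k = n" if "x \<in> A k" "x \<in> A n" for k n x
      using A(2) that by (auto simp: disjoint_family_on_def)
    then show "(\<Union>n. C n \<inter> A n) \<inter> A n = C n \<inter> A n" for n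
      by blast
    show "(\<Union>n. C n \<inter> A n) \<in> sets borel" using C Ai by auto
  qed
  have sums_B: "(\<lambda>n. \<nu> (B \<inter> A n)) sums \<nu> (B \<inter> (\<Union>n. A n))" if "B \<in> sets borel" for B
  proof -
    have "(\<lambda>n. \<nu> (B \<inter> A n)) sums \<nu> (\<Union>n. B \<inter> A n)"
      using that A Ai by (intro sums) (auto simp: disjoint_family_on_def)
    then show ?thesis by (simp only: Int_UN_distrib)
  qed
  have "(\<Sum>i. sup_on (A i)) = (SUP B\<in>sets borel. \<Sum>i. ennreal (\<nu> (B \<inter> A i)))"
    unfolding sup_on_def
  proof (rule ennreal_suminf_SUP_eq_directed)
    fix N :: "nat set" and B B' :: "complex set"
    assume B: "B \<in> sets borel" "B' \<in> sets borel"
    have "\<exists>D\<in>sets borel. \<forall>n. D \<inter> A n = (if \<nu> (B' \<inter> A n) \<le> \<nu> (B \<inter> A n) then B else B') \<inter> A n"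
      using B by (intro glue) simp
    then obtain D where D: "D \<in> sets borel"
        "\<And>n. D \<inter> A n = (if \<nu> (B' \<inter> A n) \<le> \<nu> (B \<inter> A n) then B else B') \<inter> A n"
      by blast
    show "\<exists>k\<in>sets borel. \<forall>n\<in>N. ennreal (\<nu> (B \<inter> A n)) \<le> ennreal (\<nu> (k \<inter> A n)) \<and>
        ennreal (\<nu> (B' \<inter> A n)) \<le> ennreal (\<nu> (k \<inter> A n))"
      using D by (intro bexI[of _ D]) (auto intro!: ennreal_leI)
  qed
  also have "\<dots> = sup_on (\<Union>i. A i)"
    unfolding sup_on_def
  proof (rule antisym)
    show "(SUP B\<in>sets borel. \<Sum>i. ennreal (\<nu> (B \<inter> A i))) \<le> (SUP B\<in>sets borel. ennreal (\<nu> (B \<inter> (\<Union>i. A i))))"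
    proof (rule SUP_mono)
      fix B :: "complex set" assume B: "B \<in> sets borel"
      \<comment> \<open>On pieces of negative value \<open>ennreal\<close> gives 0, and so does the
        empty set. After this change all terms are nonnegative, and the \<open>ennreal\<close>
        series is the real series.\<close>
      have "\<exists>D\<in>sets borel. \<forall>n. D \<inter> A n = (if 0 \<le> \<nu> (B \<inter> A n) then B else {}) \<inter> A n"
        using B by (intro glue) simp
      then obtain D where D: "D \<in> sets borel"
          "\<And>n. D \<inter> A n = (if 0 \<le> \<nu> (B \<inter> A n) then B else {}) \<inter> A n"
        by blast
      have "(\<Sum>i. ennreal (\<nu> (B \<inter> A i))) = (\<Sum>i. ennreal (\<nu> (D \<inter> A i)))"
        using D(2) by (intro suminf_cong) (auto simp: empty ennreal_neg)
      also have "\<dots> = ennreal (\<nu> (D \<inter> (\<Union>i. A i)))"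
        using D(2) by (intro suminf_ennreal_eq sums_B D) (auto simp: empty)
      finally show "\<exists>D\<in>sets borel. (\<Sum>i. ennreal (\<nu> (B \<inter> A i))) \<le> ennreal (\<nu> (D \<inter> (\<Union>i. A i)))"
        using D(1) by auto
    qed
    show "(SUP B\<in>sets borel. ennreal (\<nu> (B \<inter> (\<Union>i. A i)))) \<le> (SUP B\<in>sets borel. \<Sum>i. ennreal (\<nu> (B \<inter> A i)))"
    proof (rule SUP_mono)
      fix B :: "complex set" assume B: "B \<in> sets borel"
      have "(\<lambda>n. ennreal (\<Sum>i<n. \<nu> (B \<inter> A i))) \<longlonglongrightarrow> ennreal (\<nu> (B \<inter> (\<Union>i. A i)))"
        using sums_B[OF B] by (intro tendsto_ennrealI) (simp add: sums_def)
      moreover have "ennreal (\<Sum>i<n. \<nu> (B \<inter> A i)) \<le> (\<Sum>i. ennreal (\<nu> (B \<inter> A i)))" for n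
      proof -
        have "ennreal (\<Sum>i<n. \<nu> (B \<inter> A i)) \<le> ennreal (\<Sum>i<n. max 0 (\<nu> (B \<inter> A i)))"
          by (intro ennreal_leI sum_mono) auto
        also have "\<dots> = (\<Sum>i<n. ennreal (\<nu> (B \<inter> A i)))"
          by (subst sum_ennreal[symmetric], simp, intro sum.cong refl) (simp add: max_def ennreal_neg)
        also have "\<dots> \<le> (\<Sum>i. ennreal (\<nu> (B \<inter> A i)))"
          by (intro sum_le_suminf) auto
        finally show ?thesis .
      qed
      ultimately show "\<exists>D\<in>sets borel. ennreal (\<nu> (B \<inter> (\<Union>i. A i))) \<le> (\<Sum>i. ennreal (\<nu> (D \<inter> A i)))"
        using B by (intro bexI[of _ B]) (auto intro: LIMSEQ_le_const2)
    qed
  qed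
  finally show ?thesis .
qed

lemma sets_upper_variation [simp, measurable_cong]: "sets (upper_variation \<nu>) = sets borel"
  unfolding upper_variation_def using sets.sigma_sets_eq[of "borel :: complex measure"] by simp

lemma emeasure_upper_variation:
  assumes A: "A \<in> sets borel"
  shows "emeasure (upper_variation \<nu>) A = sup_on A"
proof -
  have eq: "(SUP B \<in> {B \<in> sets borel. B \<subseteq> A}. ennreal (\<nu> B)) = sup_on A" if "A \<in> sets borel" for A
    unfolding sup_on_def
  proof (rule antisym; rule SUP_mono)
    fix B assume "B \<in> {B \<in> sets borel. B \<subseteq> A}"
    then show "\<exists>C\<in>sets borel. ennreal (\<nu> B) \<le> ennreal (\<nu> (C \<inter> A))"
      by (intro bexI[of _ B]) (auto simp: Int_absorb2)
  next
    fix B :: "complex set" assume "B \<in> sets borel"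
    then show "\<exists>C\<in>{B \<in> sets borel. B \<subseteq> A}. ennreal (\<nu> (B \<inter> A)) \<le> ennreal (\<nu> C)"
      using that by (intro bexI[of _ "B \<inter> A"]) auto
  qed
  have [simp]: "sigma_sets UNIV (sets borel) = sets (borel :: complex measure)"
    using sets.sigma_sets_eq[of "borel :: complex measure"] by simp
  have "upper_variation \<nu> = measure_of UNIV (sets borel) sup_on"
    unfolding upper_variation_def by (rule measure_of_eq) (auto simp: eq)
  then show ?thesis
  proof (rule emeasure_measure_of)
    show "positive (sets (upper_variation \<nu>)) sup_on"
      by (auto simp: positive_def sup_on_def empty image_constant_conv)
    show "countably_additive (sets (upper_variation \<nu>)) sup_on"
      unfolding countably_additive_def using sup_on_suminf by simp
  qed (use A in auto)
qed

lemma sup_on_le: "A \<in> sets borel \<Longrightarrow> sup_on A \<le> emeasure T A"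
  unfolding sup_on_def emeasure_eq_measure
proof (rule SUP_least)
  fix B :: "complex set" assume AB: "A \<in> sets borel" "B \<in> sets borel"
  then have "\<nu> (B \<inter> A) \<le> measure T (B \<inter> A)" using bound[of "B \<inter> A"] by simp
  also have "\<dots> \<le> measure T A" using AB by (intro finite_measure_mono) auto
  finally show "ennreal (\<nu> (B \<inter> A)) \<le> ennreal (measure T A)" by (rule ennreal_leI)
qed

lemma upper_variation_le: "upper_variation \<nu> \<le> T"
  by (subst le_measure) (auto simp: emeasure_upper_variation intro: sup_on_le)

lemma finite_measure_upper_variation: "finite_measure (upper_variation \<nu>)"
proof (rule finite_measureI)
  have "space (upper_variation \<nu>) = UNIV" by (simp add: upper_variation_def)
  then have "emeasure (upper_variation \<nu>) (space (upper_variation \<nu>)) \<le> emeasure T UNIV"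
    using sup_on_le[of UNIV] by (simp add: emeasure_upper_variation)
  then show "emeasure (upper_variation \<nu>) (space (upper_variation \<nu>)) \<noteq> \<infinity>"
    by (auto simp: top_unique)
qed

text \<open>The value on B \<inter> A is \<nu> A minus the value on A - B, and the latter with its
  sign reversed competes in the negative variation. Used for \<nu> and for its negative, this yields
  the Jordan identity without a Hahn set.\<close>

lemma upper_variation_le_add:
  assumes A: "A \<in> sets borel"
  shows "measure (upper_variation \<nu>) A \<le> \<nu> A + measure (upper_variation (\<lambda>A. - \<nu> A)) A"
proof -
  interpret N: dominated_signed_measure T "\<lambda>A. - \<nu> A" by (rule uminus)
  interpret U: finite_measure "upper_variation \<nu>" by (rule finite_measure_upper_variation)
  interpret V: finite_measure "upper_variation (\<lambda>A. - \<nu> A)" by (rule N.finite_measure_upper_variation)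
  have le: "- \<nu> (B \<inter> A) \<le> measure (upper_variation (\<lambda>A. - \<nu> A)) A" if "B \<in> sets borel" for B
  proof -
    have "ennreal (- \<nu> (B \<inter> A)) \<le> emeasure (upper_variation (\<lambda>A. - \<nu> A)) A"
      using that unfolding N.emeasure_upper_variation[OF A] N.sup_on_def by (rule SUP_upper)
    then show ?thesis by (simp add: V.emeasure_eq_measure)
  qed
  have "emeasure (upper_variation \<nu>) A \<le> ennreal (\<nu> A + measure (upper_variation (\<lambda>A. - \<nu> A)) A)"
    unfolding emeasure_upper_variation[OF A] sup_on_def
  proof (intro SUP_least ennreal_leI)
    fix B :: "complex set" assume B: "B \<in> sets borel"
    have "\<nu> ((B \<inter> A) \<union> ((- B) \<inter> A)) = \<nu> (B \<inter> A) + \<nu> ((- B) \<inter> A)"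
      using A B by (intro add) auto
    moreover have "(B \<inter> A) \<union> ((- B) \<inter> A) = A" by blast
    ultimately show "\<nu> (B \<inter> A) \<le> \<nu> A + measure (upper_variation (\<lambda>A. - \<nu> A)) A"
      using le[of "- B"] B by auto
  qed
  moreover have "0 \<le> \<nu> A + measure (upper_variation (\<lambda>A. - \<nu> A)) A"
    using le[of A] A by simp
  ultimately show ?thesis by (simp add: U.emeasure_eq_measure)
qed

lemma jordan_decomposition:
  assumes "A \<in> sets borel"
  shows "measure (upper_variation \<nu>) A - measure (upper_variation (\<lambda>A. - \<nu> A)) A = \<nu> A"
proof -
  interpret N: dominated_signed_measure T "\<lambda>A. - \<nu> A" by (rule uminus)
  show ?thesis
    using upper_variation_le_add[OF assms] N.upper_variation_le_add[OF assms] by simp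
qed

end

section \<open>Integration against a complex measure\<close>

text \<open>Formulated for any finite dominating measure; the total variation is inserted at the
  very end, once it is known to be finite and to dominate \<mu>.\<close>

locale dominated_complex_measure = finite_measure T for T :: "complex measure" +
  fixes \<mu> :: "complex set \<Rightarrow> complex"
  assumes sets_T [simp, measurable_cong]: "sets T = sets borel"
    and complex_measure: "complex_measure \<mu>"
    and bound: "\<And>A. A \<in> sets borel \<Longrightarrow> norm (\<mu> A) \<le> measure T A"
begin

sublocale Re: dominated_signed_measure T "\<lambda>A. Re (\<mu> A)"
  using complex_measureD[OF complex_measure] bound abs_Re_le_cmod order_trans
  by unfold_locales (auto intro!: sums_Re, blast)

sublocale Im: dominated_signed_measure T "\<lambda>A. Im (\<mu> A)"
  using complex_measureD[OF complex_measure] bound abs_Im_le_cmod order_trans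
  by unfold_locales (auto intro!: sums_Im, blast)

sublocale minus_Re: dominated_signed_measure T "\<lambda>A. - Re (\<mu> A)"
  by (rule Re.uminus)

sublocale minus_Im: dominated_signed_measure T "\<lambda>A. - Im (\<mu> A)"
  by (rule Im.uminus)

text \<open>Collects the four Jordan parts so that a property of integrals is proved once for a
  generic member and then carried over to their complex combination.\<close>

definition parts :: "complex measure set" where
  "parts = {upper_variation (\<lambda>A. Re (\<mu> A)), upper_variation (\<lambda>A. - Re (\<mu> A)),
            upper_variation (\<lambda>A. Im (\<mu> A)), upper_variation (\<lambda>A. - Im (\<mu> A))}"

lemma parts_simps [simp, intro]:
  "upper_variation (\<lambda>A. Re (\<mu> A)) \<in> parts" "upper_variation (\<lambda>A. - Re (\<mu> A)) \<in> parts"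
  "upper_variation (\<lambda>A. Im (\<mu> A)) \<in> parts" "upper_variation (\<lambda>A. - Im (\<mu> A)) \<in> parts"
  by (auto simp: parts_def)

lemma space_T [simp]: "space T = UNIV"
  using sets_eq_imp_space_eq[OF sets_T] by simp

lemma partsD:
  assumes "N \<in> parts"
  shows "sets N = sets borel" "N \<le> T" "finite_measure N"
  using assms Re.upper_variation_le minus_Re.upper_variation_le Im.upper_variation_le minus_Im.upper_variation_le
    Re.finite_measure_upper_variation minus_Re.finite_measure_upper_variation
    Im.finite_measure_upper_variation minus_Im.finite_measure_upper_variation
  by (auto simp: parts_def)

lemma borel_measurable_parts:
  "N \<in> parts \<Longrightarrow> borel_measurable N = borel_measurable borel"
  by (rule measurable_cong_sets) (auto simp: partsD)

lemma nn_integral_parts_le: "N \<in> parts \<Longrightarrow> nn_integral N f \<le> nn_integral T f"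
  by (intro nn_integral_mono_measure) (auto simp: partsD)

lemma integrable_parts:
  fixes f :: "complex \<Rightarrow> complex"
  assumes N: "N \<in> parts" and f: "integrable T f"
  shows "integrable N f"
proof (rule integrableI_bounded)
  have "f \<in> borel_measurable T" using f by (rule borel_measurable_integrable)
  then show "f \<in> borel_measurable N"
    using measurable_cong_sets[of T borel borel borel] by (simp add: borel_measurable_parts[OF N])
  have "(\<integral>\<^sup>+x. ennreal (norm (f x)) \<partial>N) \<le> (\<integral>\<^sup>+x. ennreal (norm (f x)) \<partial>T)"
    by (rule nn_integral_parts_le[OF N])
  also have "\<dots> < \<infinity>" using f by (simp add: integrable_iff_bounded)
  finally show "(\<integral>\<^sup>+x. ennreal (norm (f x)) \<partial>N) < \<infinity>" .
qed

lemma AE_parts: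
  assumes N: "N \<in> parts" and "AE x in T. P x"
  shows "AE x in N. P x"
proof -
  obtain A where A: "{x\<in>space T. \<not> P x} \<subseteq> A" "emeasure T A = 0" "A \<in> sets T"
    using assms(2) by (rule AE_E)
  have "emeasure N A \<le> emeasure T A"
    using le_measureD3[OF partsD(2)[OF N], of A] A(3) by (simp add: partsD[OF N])
  then show ?thesis
    using A partsD(1)[OF N] sets_eq_imp_space_eq[OF partsD(1)[OF N]] by (intro AE_I[of N P A]) auto
qed

abbreviation I :: "(complex \<Rightarrow> complex) \<Rightarrow> complex" where
  "I \<equiv> complex_measure_integral \<mu>"

lemma integral_add:
  "integrable T f \<Longrightarrow> integrable T g \<Longrightarrow> I (\<lambda>x. f x + g x) = I f + I g"
  unfolding complex_measure_integral_def by (simp add: integrable_parts algebra_simps)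

lemma integral_diff:
  "integrable T f \<Longrightarrow> integrable T g \<Longrightarrow> I (\<lambda>x. f x - g x) = I f - I g"
  unfolding complex_measure_integral_def by (simp add: integrable_parts algebra_simps)

lemma integral_cmult: "I (\<lambda>x. c * f x) = c * I f"
  unfolding complex_measure_integral_def by (simp add: algebra_simps)

lemma integral_cong_AE:
  assumes [measurable]: "f \<in> borel_measurable borel" "g \<in> borel_measurable borel"
    and eq: "AE x in T. f x = g x"
  shows "I f = I g"
proof -
  have "integral\<^sup>L N f = integral\<^sup>L N g" if N: "N \<in> parts" for N
    using AE_parts[OF N eq] by (intro Bochner_Integration.integral_cong_AE) (auto simp: borel_measurable_parts[OF N])
  then show ?thesis by (simp add: complex_measure_integral_def)
qed

text \<open>Each of the four Jordan parts lies below \<open>T\<close>, whence the factor 4. A part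
  against which \<open>f\<close> is not integrable contributes the default value 0.\<close>

lemma norm_integral_le:
  "ennreal (norm (I f)) \<le> 4 * (\<integral>\<^sup>+x. ennreal (norm (f x)) \<partial>T)"
proof -
  have *: "ennreal (norm (integral\<^sup>L N f)) \<le> (\<integral>\<^sup>+x. ennreal (norm (f x)) \<partial>T)" if N: "N \<in> parts" for N
  proof (cases "integrable N f")
    case True
    then have "ennreal (norm (integral\<^sup>L N f)) \<le> (\<integral>\<^sup>+x. ennreal (norm (f x)) \<partial>N)"
      by (rule integral_norm_bound_ennreal)
    also have "\<dots> \<le> (\<integral>\<^sup>+x. ennreal (norm (f x)) \<partial>T)"
      by (rule nn_integral_parts_le[OF N])
    finally show ?thesis .
  qed (simp add: not_integrable_integral_eq)
  have tri: "norm (a - b + \<i> * (c - d)) \<le> norm a + norm b + (norm c + norm d)" for a b c d :: complex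
    using norm_triangle_ineq[of "a - b" "\<i> * (c - d)"] norm_triangle_ineq4[of a b] norm_triangle_ineq4[of c d]
    by (simp add: norm_mult)
  have "ennreal (norm (I f)) \<le> ennreal (norm (integral\<^sup>L (upper_variation (\<lambda>A. Re (\<mu> A))) f)
      + norm (integral\<^sup>L (upper_variation (\<lambda>A. - Re (\<mu> A))) f)
      + (norm (integral\<^sup>L (upper_variation (\<lambda>A. Im (\<mu> A))) f)
      + norm (integral\<^sup>L (upper_variation (\<lambda>A. - Im (\<mu> A))) f)))"
    unfolding complex_measure_integral_def by (intro ennreal_leI tri)
  also have "\<dots> \<le> (\<integral>\<^sup>+x. ennreal (norm (f x)) \<partial>T) + (\<integral>\<^sup>+x. ennreal (norm (f x)) \<partial>T)
      + ((\<integral>\<^sup>+x. ennreal (norm (f x)) \<partial>T) + (\<integral>\<^sup>+x. ennreal (norm (f x)) \<partial>T))"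
    by (simp, intro add_mono *) auto
  also have "\<dots> = 4 * (\<integral>\<^sup>+x. ennreal (norm (f x)) \<partial>T)"
    using distrib_right[of 2 2 "\<integral>\<^sup>+x. ennreal (norm (f x)) \<partial>T"] by (simp add: mult_2)
  finally show ?thesis .
qed

lemma integral_indicator:
  assumes A: "A \<in> sets borel"
  shows "I (\<lambda>x. indicator A x) = \<mu> A"
proof -
  have *: "integral\<^sup>L N (\<lambda>x. indicator A x :: complex) = of_real (measure N A)" if N: "N \<in> parts" for N
  proof -
    interpret N: finite_measure N by (rule partsD[OF N])
    have [simp]: "space N = UNIV" using sets_eq_imp_space_eq[OF partsD(1)[OF N]] by simp
    have "integral\<^sup>L N (\<lambda>x. indicator A x :: complex) = integral\<^sup>L N (\<lambda>x. of_real (indicator A x))"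
      by (intro Bochner_Integration.integral_cong) (auto simp: indicator_def)
    also have "\<dots> = of_real (measure N A)"
      using A by (simp add: partsD[OF N])
    finally show ?thesis .
  qed
  show ?thesis
    unfolding complex_measure_integral_def using Re.jordan_decomposition[OF A] Im.jordan_decomposition[OF A]
    by (simp add: * complex_eq_iff)
qed

lemma integral_tendsto:
  fixes g :: "complex \<Rightarrow> complex"
  assumes s: "\<And>n. s n \<in> borel_measurable borel" and g: "integrable T g"
    and lim: "\<And>x. (\<lambda>n. s n x) \<longlonglongrightarrow> f x" and le: "\<And>n x. norm (s n x) \<le> norm (g x)"
    and f: "f \<in> borel_measurable borel"
  shows "(\<lambda>n. I (s n)) \<longlonglongrightarrow> I f"
proof -
  have "(\<lambda>n. integral\<^sup>L N (s n)) \<longlonglongrightarrow> integral\<^sup>L N f" if N: "N \<in> parts" for N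
    using s f lim le integrable_parts[OF N g]
    by (intro integral_dominated_convergence[where w = "\<lambda>x. norm (g x)"])
      (auto simp: borel_measurable_parts[OF N])
  then show ?thesis
    unfolding complex_measure_integral_def by (intro tendsto_intros) auto
qed

lemma borel_measurable_integral:
  assumes f: "(\<lambda>p. f (fst p) (snd p)) \<in> borel_measurable (borel \<Otimes>\<^sub>M borel)"
  shows "(\<lambda>z. I (f z)) \<in> borel_measurable borel"
proof -
  have "(\<lambda>z. integral\<^sup>L N (f z)) \<in> borel_measurable borel" if N: "N \<in> parts" for N
  proof -
    interpret N: finite_measure N by (rule partsD[OF N])
    have "(case_prod f) \<in> borel_measurable (borel \<Otimes>\<^sub>M N)"
      unfolding case_prod_beta'
      using f measurable_cong_sets[OF sets_pair_measure_cong[OF refl partsD(1)[OF N], of borel] refl, of borel]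
      by blast
    then show ?thesis by (rule N.borel_measurable_lebesgue_integral)
  qed
  then show ?thesis
    unfolding complex_measure_integral_def
    by (intro borel_measurable_add borel_measurable_diff borel_measurable_times measurable_const) auto
qed

lemma Fubini:
  fixes f :: "complex \<Rightarrow> complex \<Rightarrow> complex"
  assumes f: "integrable (lborel \<Otimes>\<^sub>M T) (\<lambda>(z, \<zeta>). f z \<zeta>)"
  shows "I (\<lambda>\<zeta>. \<integral>z. f z \<zeta> \<partial>lborel) = (\<integral>z. I (f z) \<partial>lborel)"
proof -
  have *: "integrable lborel (\<lambda>z. integral\<^sup>L N (f z))"
    "integral\<^sup>L N (\<lambda>\<zeta>. \<integral>z. f z \<zeta> \<partial>lborel) = (\<integral>z. integral\<^sup>L N (f z) \<partial>lborel)" if N: "N \<in> parts" for N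
  proof -
    interpret N: finite_measure N by (rule partsD[OF N])
    interpret NP: pair_sigma_finite "lborel :: complex measure" N ..
    have "integrable (lborel \<Otimes>\<^sub>M N) (\<lambda>(z, \<zeta>). f z \<zeta>)"
    proof (rule integrableI_bounded)
      have "sets (lborel \<Otimes>\<^sub>M N) = sets (lborel \<Otimes>\<^sub>M T :: (complex \<times> complex) measure)"
        by (intro sets_pair_measure_cong) (auto simp: partsD[OF N])
      then show meas: "(\<lambda>(z, \<zeta>). f z \<zeta>) \<in> borel_measurable (lborel \<Otimes>\<^sub>M N)"
        using borel_measurable_integrable[OF f] measurable_cong_sets by blast
      have "(\<integral>\<^sup>+p. ennreal (norm (case p of (z, \<zeta>) \<Rightarrow> f z \<zeta>)) \<partial>(lborel \<Otimes>\<^sub>M N))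
          = (\<integral>\<^sup>+z. \<integral>\<^sup>+\<zeta>. ennreal (norm (f z \<zeta>)) \<partial>N \<partial>lborel)"
        using meas by (subst N.nn_integral_fst[symmetric]) auto
      also have "\<dots> \<le> (\<integral>\<^sup>+z. \<integral>\<^sup>+\<zeta>. ennreal (norm (f z \<zeta>)) \<partial>T \<partial>lborel)"
        by (intro nn_integral_mono nn_integral_parts_le[OF N])
      also have "\<dots> = (\<integral>\<^sup>+p. ennreal (norm (case p of (z, \<zeta>) \<Rightarrow> f z \<zeta>)) \<partial>(lborel \<Otimes>\<^sub>M T))"
        using borel_measurable_integrable[OF f] by (subst nn_integral_fst[symmetric]) auto
      also have "\<dots> < \<infinity>" using f by (simp add: integrable_iff_bounded)
      finally show "(\<integral>\<^sup>+p. ennreal (norm (case p of (z, \<zeta>) \<Rightarrow> f z \<zeta>)) \<partial>(lborel \<Otimes>\<^sub>M N)) < \<infinity>" .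
    qed
    then show "integrable lborel (\<lambda>z. integral\<^sup>L N (f z))"
      "integral\<^sup>L N (\<lambda>\<zeta>. \<integral>z. f z \<zeta> \<partial>lborel) = (\<integral>z. integral\<^sup>L N (f z) \<partial>lborel)"
      by (rule NP.integrable_fst, rule NP.Fubini_integral)
  qed
  show ?thesis
    unfolding complex_measure_integral_def by (simp add: *)
qed

end

section \<open>The Cauchy integral near a density point of its zeros\<close>

lemma ennreal_le_divide_of_mult_le:
  assumes "ennreal a * X \<le> ennreal b" "a > 0"
  shows "X \<le> ennreal (b / a)"
proof -
  have "X = ennreal (1 / a) * (ennreal a * X)"
    using assms(2) by (simp add: mult.assoc[symmetric] ennreal_mult[symmetric])
  also have "\<dots> \<le> ennreal (1 / a) * ennreal b"
    by (intro mult_left_mono assms) simp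
  also have "\<dots> \<le> ennreal (b / a)"
    using assms(2) by (cases "b \<ge> 0") (simp_all add: ennreal_mult[symmetric] ennreal_neg)
  finally show ?thesis .
qed

text \<open>What remains of a kernel when its pole is integrated over \<open>S\<close>. For
  \<open>S\<close> of finite area it is bounded in \<zeta>, unlike the kernel itself.\<close>

definition set_potential :: "complex set \<Rightarrow> complex \<Rightarrow> ennreal" where
  "set_potential S \<zeta> = (\<integral>\<^sup>+z. cauchy_kernel \<zeta> z * indicator S z \<partial>lborel)"

lemma borel_measurable_set_potential [measurable]:
  assumes [measurable]: "S \<in> sets borel"
  shows "set_potential S \<in> borel_measurable borel"
  unfolding set_potential_def[abs_def] by measurable

text \<open>For \<open>k = 0\<close> the bound holds at every \<zeta> and reflects the size of
  \<open>S\<close>, with \<sigma>^2 bounding the area ratio. For positive \<open>k\<close> the point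
  \<zeta> is at least 2^k r / 2 away from \<open>S\<close>, and the decay comes from the
  distance.\<close>

lemma set_potential_le:
  assumes S[measurable]: "S \<in> sets borel" and sub: "S \<subseteq> ball w r" and r: "r > 0"
    and \<sigma>: "0 < \<sigma>" "\<sigma> \<le> 1" and mS: "emeasure lborel S \<le> ennreal (pi * \<sigma>\<^sup>2 * r\<^sup>2)"
    and k: "k = 0 \<or> 2 ^ k * r \<le> norm (\<zeta> - w)"
  shows "set_potential S \<zeta> \<le> ennreal (5 * pi * \<sigma> * r / 2 ^ k)"
proof (cases "k = 0")
  case True
  \<comment> \<open>Splitting at distance \<sigma> r gives both terms the same order, pi \<sigma> r
    + 4 pi \<sigma> r; hence the constant 5.\<close>
  have "set_potential S \<zeta> \<le> ennreal (1 / (\<sigma> * r)) * emeasure lborel S + ennreal (4 * pi * (\<sigma> * r))"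
    unfolding set_potential_def using \<sigma> r by (intro nn_integral_cauchy_kernel_le S) simp
  also have "\<dots> \<le> ennreal (1 / (\<sigma> * r)) * ennreal (pi * \<sigma>\<^sup>2 * r\<^sup>2) + ennreal (4 * pi * (\<sigma> * r))"
    by (intro add_right_mono mult_left_mono mS) simp
  also have "\<dots> = ennreal (1 / (\<sigma> * r) * (pi * \<sigma>\<^sup>2 * r\<^sup>2) + 4 * pi * (\<sigma> * r))"
    using \<sigma> r by (simp add: ennreal_mult[symmetric] ennreal_plus[symmetric] del: ennreal_plus)
  also have "1 / (\<sigma> * r) * (pi * \<sigma>\<^sup>2 * r\<^sup>2) + 4 * pi * (\<sigma> * r) = 5 * pi * \<sigma> * r / 2 ^ k"
    using \<sigma> r True by (simp add: field_simps power2_eq_square)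
  finally show ?thesis .
next
  case False
  then have k2: "2 ^ k * r \<le> norm (\<zeta> - w)" "2 \<le> (2::real) ^ k"
    using k power_increasing[of 1 k "2::real"] by auto
  have "set_potential S \<zeta> \<le> (\<integral>\<^sup>+z. ennreal (1 / (2 ^ k * r / 2)) * indicator S z \<partial>lborel)"
    unfolding set_potential_def
  proof (intro nn_integral_mono)
    fix z
    show "cauchy_kernel \<zeta> z * indicator S z \<le> ennreal (1 / (2 ^ k * r / 2)) * indicator S z"
    proof (cases "z \<in> S")
      case True
      then have "norm (z - w) < r" using sub by (auto simp: dist_norm norm_minus_commute)
      moreover have "norm (\<zeta> - w) \<le> norm (\<zeta> - z) + norm (z - w)"
        using norm_triangle_ineq[of "\<zeta> - z" "z - w"] by simp
      moreover have "r \<le> 2 ^ k * r / 2" using k2(2) r by (simp add: field_simps)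
      ultimately have "2 ^ k * r / 2 \<le> norm (\<zeta> - z)" using k2(1) by linarith
      then show ?thesis using True r cauchy_kernel_le[of "2 ^ k * r / 2" \<zeta> z] by simp
    qed simp
  qed
  also have "\<dots> = ennreal (1 / (2 ^ k * r / 2)) * emeasure lborel S"
    by (rule nn_integral_cmult_indicator) simp
  also have "\<dots> \<le> ennreal (1 / (2 ^ k * r / 2)) * ennreal (pi * \<sigma>\<^sup>2 * r\<^sup>2)"
    by (intro mult_left_mono mS) simp
  also have "\<dots> = ennreal (2 * pi * \<sigma> * r / 2 ^ k * \<sigma>)"
    using r \<sigma> by (subst ennreal_mult[symmetric]) (auto simp: field_simps power2_eq_square)
  \<comment> \<open>The far bound even contains \<sigma>^2. One factor is given up to match the form
    of the case \<open>k = 0\<close>.\<close>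
  also have "\<dots> \<le> ennreal (5 * pi * \<sigma> * r / 2 ^ k)"
  proof (rule ennreal_leI)
    have "2 * pi * \<sigma> * r / 2 ^ k * \<sigma> \<le> 2 * pi * \<sigma> * r / 2 ^ k * 1"
      using \<sigma> r by (intro mult_left_mono) auto
    also have "\<dots> \<le> 5 * pi * \<sigma> * r / 2 ^ k"
      using \<sigma> r by (simp add: divide_right_mono)
    finally show "2 * pi * \<sigma> * r / 2 ^ k * \<sigma> \<le> 5 * pi * \<sigma> * r / 2 ^ k" .
  qed
  finally show ?thesis .
qed

section \<open>Absolute convergence of the Cauchy integral and its zeros\<close>

context dominated_complex_measure
begin

definition potential :: "complex \<Rightarrow> ennreal" where
  "potential z = (\<integral>\<^sup>+\<zeta>. cauchy_kernel \<zeta> z \<partial>T)"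

definition cauchy_integral :: "complex \<Rightarrow> complex" where
  "cauchy_integral z = I (\<lambda>\<zeta>. 1 / (\<zeta> - z))"

lemma borel_measurable_potential [measurable]: "potential \<in> borel_measurable borel"
  unfolding potential_def[abs_def] by measurable

lemma borel_measurable_cauchy_integral [measurable]: "cauchy_integral \<in> borel_measurable borel"
  unfolding cauchy_integral_def[abs_def] by (rule borel_measurable_integral) measurable

text \<open>Tonelli. The weight \<open>g\<close> holds the factors that do not involve the pole
  being integrated, so that several poles can be treated one after another.\<close>

lemma nn_integral_kernel_swap:
  assumes [measurable]: "S \<in> sets borel" "g \<in> borel_measurable borel"
  shows "(\<integral>\<^sup>+z. (\<integral>\<^sup>+\<zeta>. cauchy_kernel \<zeta> z * g \<zeta> \<partial>T) * indicator S z \<partial>lborel)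
       = (\<integral>\<^sup>+\<zeta>. set_potential S \<zeta> * g \<zeta> \<partial>T)"
proof -
  interpret P: pair_sigma_finite "lborel :: complex measure" T ..
  have "(\<integral>\<^sup>+z. (\<integral>\<^sup>+\<zeta>. cauchy_kernel \<zeta> z * g \<zeta> \<partial>T) * indicator S z \<partial>lborel)
      = (\<integral>\<^sup>+z. (\<integral>\<^sup>+\<zeta>. cauchy_kernel \<zeta> z * indicator S z * g \<zeta> \<partial>T) \<partial>lborel)"
    by (intro nn_integral_cong) (auto simp: indicator_def)
  also have "\<dots> = (\<integral>\<^sup>+\<zeta>. (\<integral>\<^sup>+z. cauchy_kernel \<zeta> z * indicator S z * g \<zeta> \<partial>lborel) \<partial>T)"
    by (rule P.Fubini'[symmetric]) measurable
  also have "\<dots> = (\<integral>\<^sup>+\<zeta>. set_potential S \<zeta> * g \<zeta> \<partial>T)"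
    unfolding set_potential_def by (intro nn_integral_cong nn_integral_multc) measurable
  finally show ?thesis .
qed

lemma nn_integral_set_potential_finite:
  assumes r: "r > 0"
  shows "(\<integral>\<^sup>+\<zeta>. set_potential (ball w r) \<zeta> \<partial>T) < \<infinity>"
proof -
  have "(\<integral>\<^sup>+\<zeta>. set_potential (ball w r) \<zeta> \<partial>T) \<le> (\<integral>\<^sup>+\<zeta>. ennreal (5 * pi * 1 * r / 2 ^ 0) \<partial>T)"
    using r by (intro nn_integral_mono set_potential_le[of _ w]) (auto simp: emeasure_ball_complex)
  also have "\<dots> < \<infinity>"
    by (simp add: emeasure_eq_measure ennreal_mult[symmetric] ennreal_mult_less_top)
  finally show ?thesis .
qed

text \<open>However singular \<open>T\<close> is, the area integral of its potential over a disc is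
  the \<open>T\<close>-integral of a bounded function and so finite. Discs centred at 0 exhaust the
  plane.\<close>

lemma AE_potential_finite: "AE z in lborel. potential z < \<infinity>"
proof -
  have "AE z in lborel. \<forall>n::nat. z \<in> ball 0 (real (Suc n)) \<longrightarrow> potential z < \<infinity>"
  proof (subst AE_all_countable, rule allI)
    fix n
    have "(\<integral>\<^sup>+z. potential z * indicator (ball 0 (real (Suc n))) z \<partial>lborel)
        = (\<integral>\<^sup>+\<zeta>. set_potential (ball 0 (real (Suc n))) \<zeta> \<partial>T)"
      using nn_integral_kernel_swap[of "ball 0 (real (Suc n))" "\<lambda>_. 1"] by (simp add: potential_def)
    also have "\<dots> < \<infinity>" by (rule nn_integral_set_potential_finite) simp
    finally have "AE z in lborel. potential z * indicator (ball 0 (real (Suc n))) z \<noteq> \<infinity>"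
      by (intro nn_integral_PInf_AE) auto
    then show "AE z in lborel. z \<in> ball 0 (real (Suc n)) \<longrightarrow> potential z < \<infinity>"
      by eventually_elim (auto simp: indicator_def less_top)
  qed
  then show ?thesis
  proof eventually_elim
    case (elim z)
    obtain n :: nat where "norm z < real n" using reals_Archimedean2 by blast
    then show ?case using elim by (intro elim[rule_format, of n]) auto
  qed
qed

lemma potential_finiteD:
  assumes "potential z < \<infinity>"
  shows "integrable T (\<lambda>\<zeta>. 1 / (\<zeta> - z))" "AE \<zeta> in T. \<zeta> \<noteq> z"
proof -
  show "integrable T (\<lambda>\<zeta>. 1 / (\<zeta> - z))"
  proof (rule integrableI_bounded)
    show "(\<lambda>\<zeta>. 1 / (\<zeta> - z)) \<in> borel_measurable T" by measurable
    have "(\<integral>\<^sup>+\<zeta>. ennreal (norm (1 / (\<zeta> - z))) \<partial>T) \<le> potential z"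
      unfolding potential_def by (intro nn_integral_mono ennreal_norm_inverse_le_cauchy_kernel)
    then show "(\<integral>\<^sup>+\<zeta>. ennreal (norm (1 / (\<zeta> - z))) \<partial>T) < \<infinity>"
      using assms by (rule le_less_trans)
  qed
  have "AE \<zeta> in T. cauchy_kernel \<zeta> z \<noteq> \<infinity>"
    using assms unfolding potential_def by (intro nn_integral_PInf_AE) auto
  then show "AE \<zeta> in T. \<zeta> \<noteq> z"
    by eventually_elim (auto simp: cauchy_kernel_def)
qed

text \<open>A finite potential makes the kernel integrable, and dominated convergence along
  \<epsilon> = 1 / (n + 1) identifies the principal value with the full integral.\<close>

lemma cauchy_integral_eq_0:
  assumes fin: "potential z < \<infinity>" and lim: "has_cauchy_transform \<mu> z 0"
  shows "cauchy_integral z = 0"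
proof -
  define s where "s n \<zeta> = indicator {\<zeta>. norm (\<zeta> - z) > inverse (real (Suc n))} \<zeta> *\<^sub>R (1 / (\<zeta> - z))" for n \<zeta>
  have "(\<lambda>n. I (s n)) \<longlonglongrightarrow> I (\<lambda>\<zeta>. 1 / (\<zeta> - z))"
  proof (rule integral_tendsto[OF _ potential_finiteD(1)[OF fin]])
    show "s n \<in> borel_measurable borel" for n unfolding s_def[abs_def] by measurable
    show "norm (s n \<zeta>) \<le> norm (1 / (\<zeta> - z))" for n \<zeta> by (auto simp: s_def indicator_def)
    show "(\<lambda>n. s n \<zeta>) \<longlonglongrightarrow> 1 / (\<zeta> - z)" for \<zeta>
    proof (cases "\<zeta> = z")
      case False
      then have "\<forall>\<^sub>F n in sequentially. inverse (real (Suc n)) < norm (\<zeta> - z)"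
        using order_tendstoD(2)[OF LIMSEQ_inverse_real_of_nat] by simp
      then have "\<forall>\<^sub>F n in sequentially. s n \<zeta> = 1 / (\<zeta> - z)"
        by eventually_elim (simp add: s_def)
      then show ?thesis by (rule tendsto_eventually)
    \<comment> \<open>At \<zeta> = z both sides are 0, since division by zero yields 0.\<close>
    qed (simp add: s_def)
  qed measurable
  moreover have "filterlim (\<lambda>n. inverse (real (Suc n))) (at_right 0) sequentially"
    using LIMSEQ_inverse_real_of_nat by (intro filterlim_at_withinI always_eventually) auto
  then have "(\<lambda>n. I (s n)) \<longlonglongrightarrow> 0"
    using lim unfolding has_cauchy_transform_def s_def by (rule filterlim_compose[rotated])
  ultimately show ?thesis
    unfolding cauchy_integral_def using LIMSEQ_unique by blast
qed

text \<open>
  The second divided difference of \<open>1 / (\<zeta> - z)\<close> at two zeros of the Cauchy integral gains two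
  powers of decay in \<open>\<zeta>\<close>, so that the far part of the measure becomes harmless.
\<close>
lemma norm_cauchy_integral_le:
  assumes fin: "potential z < \<infinity>" "potential z0 < \<infinity>" "potential z1 < \<infinity>"
    and ne: "z \<noteq> z0" "z \<noteq> z1" "z0 \<noteq> z1"
    and zero: "cauchy_integral z0 = 0" "cauchy_integral z1 = 0"
  shows "ennreal (norm (cauchy_integral z)) \<le> ennreal (4 * norm (z - z0) * norm (z - z1)) *
    (\<integral>\<^sup>+\<zeta>. cauchy_kernel \<zeta> z1 * (cauchy_kernel \<zeta> z0 * cauchy_kernel \<zeta> z) \<partial>T)"
proof -
  \<comment> \<open>Weights with 1 + a + b = 0 and z + a z0 + b z1 = 0. These cancel the terms of
    order 1 / \<zeta> and 1 / \<zeta>^2 at infinity in the combination of the three kernels; adding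
    the integrals at \<open>z0\<close> and \<open>z1\<close> changes nothing, as they
    vanish.\<close>
  define a where "a = - (z - z1) / (z0 - z1)"
  define b where "b = (z - z0) / (z0 - z1)"
  note int = fin[THEN potential_finiteD(1)]
  have i0: "integrable T (\<lambda>\<zeta>. a * (1 / (\<zeta> - z0)))"
    by (rule integrable_mult_right) (rule int)
  have i1: "integrable T (\<lambda>\<zeta>. b * (1 / (\<zeta> - z1)))"
    by (rule integrable_mult_right) (rule int)
  have "cauchy_integral z = I (\<lambda>\<zeta>. 1 / (\<zeta> - z)) + (I (\<lambda>\<zeta>. a * (1 / (\<zeta> - z0))) + I (\<lambda>\<zeta>. b * (1 / (\<zeta> - z1))))"
    using zero by (simp only: integral_cmult cauchy_integral_def) simp
  also have "\<dots> = I (\<lambda>\<zeta>. 1 / (\<zeta> - z) + (a * (1 / (\<zeta> - z0)) + b * (1 / (\<zeta> - z1))))"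
    by (simp only: integral_add[OF int(1) Bochner_Integration.integrable_add[OF i0 i1]] integral_add[OF i0 i1])
  also have "\<dots> = I (\<lambda>\<zeta>. ((z - z0) * (z - z1)) * (1 / ((\<zeta> - z1) * ((\<zeta> - z0) * (\<zeta> - z)))))"
  \<comment> \<open>The algebraic identity requires \<zeta> to differ from all three poles, which
    the finite potentials guarantee almost everywhere.\<close>
  proof (rule integral_cong_AE)
    show "AE \<zeta> in T. 1 / (\<zeta> - z) + (a * (1 / (\<zeta> - z0)) + b * (1 / (\<zeta> - z1)))
        = ((z - z0) * (z - z1)) * (1 / ((\<zeta> - z1) * ((\<zeta> - z0) * (\<zeta> - z))))"
      using fin[THEN potential_finiteD(2)]
    proof eventually_elim
      case (elim \<zeta>)
      have "1 / p + (- (s - p) / (s - q) * (1 / q) + (q - p) / (s - q) * (1 / s))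
          = ((q - p) * (s - p)) * (1 / (s * (q * p)))"
        if "p \<noteq> 0" "q \<noteq> 0" "s \<noteq> 0" "s \<noteq> q" for p q s :: complex
        using that by (simp add: divide_simps) (simp add: algebra_simps)
      from this[of "\<zeta> - z" "\<zeta> - z0" "\<zeta> - z1"] show ?case
        using elim ne unfolding a_def b_def by simp
    qed
  qed measurable
  finally have eq: "cauchy_integral z = (z - z0) * (z - z1) * I (\<lambda>\<zeta>. 1 / ((\<zeta> - z1) * ((\<zeta> - z0) * (\<zeta> - z))))"
    by (simp only: integral_cmult)
  have "ennreal (norm (cauchy_integral z)) = ennreal (norm (z - z0) * norm (z - z1))
      * ennreal (norm (I (\<lambda>\<zeta>. 1 / ((\<zeta> - z1) * ((\<zeta> - z0) * (\<zeta> - z))))))"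
    by (simp add: eq norm_mult ennreal_mult)
  also have "\<dots> \<le> ennreal (norm (z - z0) * norm (z - z1)) *
      (4 * (\<integral>\<^sup>+\<zeta>. ennreal (norm (1 / ((\<zeta> - z1) * ((\<zeta> - z0) * (\<zeta> - z))))) \<partial>T))"
    by (intro mult_left_mono norm_integral_le) simp
  also have "\<dots> \<le> ennreal (norm (z - z0) * norm (z - z1)) *
      (4 * (\<integral>\<^sup>+\<zeta>. cauchy_kernel \<zeta> z1 * (cauchy_kernel \<zeta> z0 * cauchy_kernel \<zeta> z) \<partial>T))"
  proof (intro mult_left_mono nn_integral_mono)
    fix \<zeta>
    have "ennreal (norm (1 / ((\<zeta> - z1) * ((\<zeta> - z0) * (\<zeta> - z)))))
        = ennreal (norm (1 / (\<zeta> - z1))) * (ennreal (norm (1 / (\<zeta> - z0))) * ennreal (norm (1 / (\<zeta> - z))))"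
      by (simp add: ennreal_mult[symmetric] norm_divide norm_mult)
    also have "\<dots> \<le> cauchy_kernel \<zeta> z1 * (cauchy_kernel \<zeta> z0 * cauchy_kernel \<zeta> z)"
      by (intro mult_mono ennreal_norm_inverse_le_cauchy_kernel) auto
    finally show "ennreal (norm (1 / ((\<zeta> - z1) * ((\<zeta> - z0) * (\<zeta> - z)))))
        \<le> cauchy_kernel \<zeta> z1 * (cauchy_kernel \<zeta> z0 * cauchy_kernel \<zeta> z)" .
  qed auto
  also have "ennreal (norm (z - z0) * norm (z - z1)) *
      (4 * (\<integral>\<^sup>+\<zeta>. cauchy_kernel \<zeta> z1 * (cauchy_kernel \<zeta> z0 * cauchy_kernel \<zeta> z) \<partial>T))
    = ennreal (4 * norm (z - z0) * norm (z - z1)) *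
      (\<integral>\<^sup>+\<zeta>. cauchy_kernel \<zeta> z1 * (cauchy_kernel \<zeta> z0 * cauchy_kernel \<zeta> z) \<partial>T)"
    by (simp add: ennreal_mult mult_ac)
  finally show ?thesis .
qed

section \<open>Averaging over poles and summing over dyadic rings\<close>

text \<open>One averaging step: integrating a pointwise bound over the pole in \<open>S\<close>
  turns that kernel into a potential and leaves the weight alone. It serves for both zeros over
  \<open>G\<close> and then for the point in \<open>F\<close>.\<close>

lemma nn_integral_le_set_potential:
  assumes S[measurable]: "S \<in> sets borel" and g[measurable]: "g \<in> borel_measurable borel"
    and le: "AE z in lborel. z \<in> S \<longrightarrow> c z \<le> a * (\<integral>\<^sup>+\<zeta>. cauchy_kernel \<zeta> z * g \<zeta> \<partial>T)"
  shows "(\<integral>\<^sup>+z. c z * indicator S z \<partial>lborel) \<le> a * (\<integral>\<^sup>+\<zeta>. set_potential S \<zeta> * g \<zeta> \<partial>T)"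
proof -
  have "(\<integral>\<^sup>+z. c z * indicator S z \<partial>lborel)
      \<le> (\<integral>\<^sup>+z. a * ((\<integral>\<^sup>+\<zeta>. cauchy_kernel \<zeta> z * g \<zeta> \<partial>T) * indicator S z) \<partial>lborel)"
    using le by (intro nn_integral_mono_AE) (auto simp: indicator_def elim!: eventually_mono)
  also have "\<dots> = a * (\<integral>\<^sup>+z. (\<integral>\<^sup>+\<zeta>. cauchy_kernel \<zeta> z * g \<zeta> \<partial>T) * indicator S z \<partial>lborel)"
    by (intro nn_integral_cmult) measurable
  also have "\<dots> = a * (\<integral>\<^sup>+\<zeta>. set_potential S \<zeta> * g \<zeta> \<partial>T)"
    by (simp only: nn_integral_kernel_swap[OF S g])
  finally show ?thesis .
qed

text \<open>On the dyadic ring k the potential of \<open>F\<close> is at most 5 pi \<eta> r / 2^k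
  and that of \<open>G\<close> at most 5 pi r / 2^k, while the disc of radius 2^(k+1) r has mass at
  most 4 M 4^k r^2. The product decays like 2^-k; a single factor from \<open>G\<close> would leave
  no decay.\<close>

lemma nn_integral_set_potentials_le:
  assumes F[measurable]: "F \<in> sets borel" "F \<subseteq> ball w r" and G[measurable]: "G \<in> sets borel" "G \<subseteq> ball w r"
    and r: "r > 0" and \<eta>: "0 < \<eta>" "\<eta> \<le> 1" and mF: "emeasure lborel F \<le> ennreal (pi * \<eta>\<^sup>2 * r\<^sup>2)"
    and M: "M \<ge> 0" "\<And>s. s > 0 \<Longrightarrow> measure T (ball w s) \<le> M * s\<^sup>2"
  shows "(\<integral>\<^sup>+\<zeta>. set_potential F \<zeta> * (set_potential G \<zeta> * set_potential G \<zeta>) \<partial>T)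
    \<le> ennreal (1000 * pi ^ 3 * \<eta> * M * r ^ 5)"
proof -
  have mG: "emeasure lborel G \<le> ennreal (pi * 1\<^sup>2 * r\<^sup>2)"
    using emeasure_mono[OF G(2), of lborel] r by (simp add: emeasure_ball_complex)
  \<comment> \<open>The product of the three potential bounds: 125 = 5^3 and 8^k is the cube of
    2^k.\<close>
  define c where "c k = 125 * pi ^ 3 * \<eta> * r ^ 3 / 8 ^ k" for k :: nat
  have "(\<integral>\<^sup>+\<zeta>. set_potential F \<zeta> * (set_potential G \<zeta> * set_potential G \<zeta>) \<partial>T)
      \<le> (\<integral>\<^sup>+\<zeta>. (\<Sum>k. ennreal (c k) * indicator (ball w (2 ^ Suc k * r)) \<zeta>) \<partial>T)"
  proof (rule nn_integral_mono)
    fix \<zeta>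
    have ex: "\<exists>k. norm (\<zeta> - w) < 2 ^ Suc k * r"
    proof -
      obtain n where "norm (\<zeta> - w) / r < 2 ^ n"
        using real_arch_pow[of 2 "norm (\<zeta> - w) / r"] by auto
      then have "norm (\<zeta> - w) < 2 ^ n * r" using r by (simp add: field_simps)
      also have "2 ^ n * r \<le> 2 ^ Suc n * r" using r by simp
      finally show ?thesis by blast
    qed
    \<comment> \<open>Locates the ring of \<zeta>; \<open>k = 0\<close> stands for the whole disc of
      radius 2 r.\<close>
    define k where "k = (LEAST k. norm (\<zeta> - w) < 2 ^ Suc k * r)"
    have k1: "norm (\<zeta> - w) < 2 ^ Suc k * r"
      unfolding k_def by (rule LeastI_ex) (rule ex)
    have k2: "k = 0 \<or> 2 ^ k * r \<le> norm (\<zeta> - w)"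
    proof (cases k)
      case (Suc m)
      then have "m < (LEAST k. norm (\<zeta> - w) < 2 ^ Suc k * r)" by (simp add: k_def)
      from not_less_Least[OF this] show ?thesis using Suc by simp
    qed simp
    have "set_potential F \<zeta> * (set_potential G \<zeta> * set_potential G \<zeta>)
        \<le> ennreal (5 * pi * \<eta> * r / 2 ^ k) * (ennreal (5 * pi * 1 * r / 2 ^ k) * ennreal (5 * pi * 1 * r / 2 ^ k))"
      using F G r \<eta> mF mG k2 by (intro mult_mono set_potential_le) auto
    also have "\<dots> = ennreal (5 * pi * \<eta> * r / 2 ^ k * (5 * pi * 1 * r / 2 ^ k * (5 * pi * 1 * r / 2 ^ k)))"
      using r \<eta> by (simp add: ennreal_mult[symmetric])
    also have "5 * pi * \<eta> * r / 2 ^ k * (5 * pi * 1 * r / 2 ^ k * (5 * pi * 1 * r / 2 ^ k)) = c k"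
    proof -
      have "(8::real) ^ k = 2 ^ k * (2 ^ k * 2 ^ k)"
        by (simp flip: power_mult_distrib)
      then show ?thesis by (simp add: c_def power3_eq_cube)
    qed
    also have "ennreal (c k) = ennreal (c k) * indicator (ball w (2 ^ Suc k * r)) \<zeta>"
      using k1 by (simp add: dist_norm norm_minus_commute)
    also have "\<dots> \<le> (\<Sum>k. ennreal (c k) * indicator (ball w (2 ^ Suc k * r)) \<zeta>)"
      by (rule ennreal_le_suminf)
    finally show "set_potential F \<zeta> * (set_potential G \<zeta> * set_potential G \<zeta>)
      \<le> (\<Sum>k. ennreal (c k) * indicator (ball w (2 ^ Suc k * r)) \<zeta>)" .
  qed
  also have "\<dots> = (\<Sum>k. ennreal (c k) * emeasure T (ball w (2 ^ Suc k * r)))"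
    by (subst nn_integral_suminf, measurable) (simp add: nn_integral_cmult_indicator)
  also have "\<dots> \<le> (\<Sum>k. ennreal (500 * pi ^ 3 * \<eta> * M * r ^ 5 * (1/2) ^ k))"
  proof (intro suminf_le summableI)
    fix k
    have "ennreal (c k) * emeasure T (ball w (2 ^ Suc k * r)) \<le> ennreal (c k) * ennreal (M * (2 ^ Suc k * r)\<^sup>2)"
      unfolding emeasure_eq_measure using r by (intro mult_left_mono ennreal_leI M) auto
    also have "\<dots> = ennreal (c k * (M * (2 ^ Suc k * r)\<^sup>2))"
      using M(1) r \<eta> by (simp add: ennreal_mult[symmetric] c_def)
    also have "c k * (M * (2 ^ Suc k * r)\<^sup>2) = 500 * pi ^ 3 * \<eta> * M * r ^ 5 * (1/2) ^ k"
    proof -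
      have "(8::real) ^ k = 2 ^ k * (2 ^ k * 2 ^ k)"
        by (simp flip: power_mult_distrib)
      then show ?thesis
        by (simp add: c_def power_mult_distrib power_divide field_simps power2_eq_square)
          (simp add: eval_nat_numeral)
    qed
    finally show "ennreal (c k) * emeasure T (ball w (2 ^ Suc k * r))
        \<le> ennreal (500 * pi ^ 3 * \<eta> * M * r ^ 5 * (1/2) ^ k)" .
  qed
  also have "\<dots> = ennreal (500 * pi ^ 3 * \<eta> * M * r ^ 5 * 2)"
  proof -
    have "(\<lambda>k. 500 * pi ^ 3 * \<eta> * M * r ^ 5 * (1/2) ^ k) sums (500 * pi ^ 3 * \<eta> * M * r ^ 5 * 2)"
      using geometric_sums[of "1/2::real"] by (intro sums_mult) simp
    then show ?thesis using r M(1) \<eta> by (subst suminf_ennreal_eq) auto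
  qed
  finally show ?thesis by (simp add: mult_ac)
qed

text \<open>Averaging both zeros over \<open>G\<close> permits division by (pi r^2 / 2)^2. Since 16
  r^2 times 1000 pi^3 \<eta> M r^5 is the bound before this division, the constant 64000 and the
  power r^3 result.\<close>

lemma nn_integral_cauchy_integral_le:
  assumes F[measurable]: "F \<in> sets borel" and G[measurable]: "G \<in> sets borel"
    and FG: "F \<union> G = ball w r" "F \<inter> G = {}"
    and r: "r > 0" and \<eta>: "0 < \<eta>" "\<eta> \<le> 1" and mF: "emeasure lborel F \<le> ennreal (pi * \<eta>\<^sup>2 * r\<^sup>2)"
    and mG: "ennreal (pi * r\<^sup>2 / 2) \<le> emeasure lborel G"
    and M: "M \<ge> 0" "\<And>s. s > 0 \<Longrightarrow> measure T (ball w s) \<le> M * s\<^sup>2"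
    and zero: "\<And>z. z \<in> G \<Longrightarrow> potential z < \<infinity> \<and> cauchy_integral z = 0"
  shows "(\<integral>\<^sup>+z. ennreal (norm (cauchy_integral z)) * indicator F z \<partial>lborel)
    \<le> ennreal (64000 * pi * \<eta> * M * r ^ 3)"
proof -
  \<comment> \<open>This is 4 (2 r)^2: the factor 4 of \<open>norm_integral_le\<close> and two
    distances of at most the diameter.\<close>
  define a where "a = ennreal (16 * r\<^sup>2)"
  define m where "m = ennreal (pi * r\<^sup>2 / 2)"
  have sub: "F \<subseteq> ball w r" "G \<subseteq> ball w r" using FG by auto
  have bnd: "ennreal (norm (cauchy_integral z)) \<le> a * (\<integral>\<^sup>+\<zeta>. cauchy_kernel \<zeta> z1 * (cauchy_kernel \<zeta> z0 * cauchy_kernel \<zeta> z) \<partial>T)"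
    if z: "z \<in> F" "potential z < \<infinity>" "z0 \<in> G" "z1 \<in> G" "z0 \<noteq> z1" for z z0 z1
  proof -
    have d: "norm (x - y) \<le> 2 * r" if "x \<in> ball w r" "y \<in> ball w r" for x y
      using that norm_triangle_ineq4[of "x - w" "y - w"] by (simp add: dist_norm norm_minus_commute)
    have "4 * norm (z - z0) * norm (z - z1) \<le> 4 * (2 * r) * (2 * r)"
      using z sub r by (intro mult_mono d) auto
    then have "4 * norm (z - z0) * norm (z - z1) \<le> 16 * r\<^sup>2" by (simp add: power2_eq_square)
    moreover have "z \<noteq> z0" "z \<noteq> z1" using z FG by auto
    ultimately show ?thesis
      unfolding a_def using z zero
      by (intro order_trans[OF norm_cauchy_integral_le[of z z0 z1]] mult_right_mono ennreal_leI) auto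
  qed
  have avg1: "m * ennreal (norm (cauchy_integral z))
      \<le> a * (\<integral>\<^sup>+\<zeta>. cauchy_kernel \<zeta> z0 * (set_potential G \<zeta> * cauchy_kernel \<zeta> z) \<partial>T)"
    if z: "z \<in> F" "potential z < \<infinity>" "z0 \<in> G" for z z0
  proof -
    have "m * ennreal (norm (cauchy_integral z)) \<le> emeasure lborel G * ennreal (norm (cauchy_integral z))"
      using mG by (simp add: m_def mult_right_mono)
    also have "\<dots> = (\<integral>\<^sup>+z1. ennreal (norm (cauchy_integral z)) * indicator G z1 \<partial>lborel)"
      using G by (subst nn_integral_cmult_indicator) (auto simp: mult.commute)
    also have "\<dots> \<le> a * (\<integral>\<^sup>+\<zeta>. set_potential G \<zeta> * (cauchy_kernel \<zeta> z0 * cauchy_kernel \<zeta> z) \<partial>T)"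
      \<comment> \<open>The interpolation needs distinct zeros; the excluded single point has no
        area.\<close>
      using AE_lborel_singleton[of z0] bnd[OF z(1,2,3)]
      by (intro nn_integral_le_set_potential) (auto elim!: eventually_mono)
    finally show ?thesis by (simp add: mult_ac)
  qed
  have avg2: "m * m * ennreal (norm (cauchy_integral z))
      \<le> a * (\<integral>\<^sup>+\<zeta>. cauchy_kernel \<zeta> z * (set_potential G \<zeta> * set_potential G \<zeta>) \<partial>T)"
    if z: "z \<in> F" "potential z < \<infinity>" for z
  proof -
    have "m * (m * ennreal (norm (cauchy_integral z))) \<le> emeasure lborel G * (m * ennreal (norm (cauchy_integral z)))"
      using mG by (simp add: m_def mult_right_mono)
    also have "\<dots> = (\<integral>\<^sup>+z0. m * ennreal (norm (cauchy_integral z)) * indicator G z0 \<partial>lborel)"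
      using G by (subst nn_integral_cmult_indicator) (auto simp: mult.commute)
    also have "\<dots> \<le> a * (\<integral>\<^sup>+\<zeta>. set_potential G \<zeta> * (set_potential G \<zeta> * cauchy_kernel \<zeta> z) \<partial>T)"
      using avg1[OF z] by (intro nn_integral_le_set_potential) auto
    finally show ?thesis by (simp add: mult_ac)
  qed
  have "m * m * (\<integral>\<^sup>+z. ennreal (norm (cauchy_integral z)) * indicator F z \<partial>lborel)
      = (\<integral>\<^sup>+z. m * m * ennreal (norm (cauchy_integral z)) * indicator F z \<partial>lborel)"
    unfolding mult.assoc[of "m * m"] by (rule nn_integral_cmult[symmetric]) measurable
  also have "\<dots> \<le> a * (\<integral>\<^sup>+\<zeta>. set_potential F \<zeta> * (set_potential G \<zeta> * set_potential G \<zeta>) \<partial>T)"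
    using AE_potential_finite avg2 by (intro nn_integral_le_set_potential) (auto elim!: eventually_mono)
  also have "\<dots> \<le> a * ennreal (1000 * pi ^ 3 * \<eta> * M * r ^ 5)"
    using F G sub r \<eta> mF M by (intro mult_left_mono nn_integral_set_potentials_le) auto
  also have "\<dots> = ennreal (16 * r\<^sup>2 * (1000 * pi ^ 3 * \<eta> * M * r ^ 5))"
    using r \<eta> M by (simp add: a_def ennreal_mult[symmetric])
  also have "m * m = ennreal ((pi * r\<^sup>2 / 2) * (pi * r\<^sup>2 / 2))"
    by (simp add: m_def ennreal_mult[symmetric])
  finally have "(\<integral>\<^sup>+z. ennreal (norm (cauchy_integral z)) * indicator F z \<partial>lborel)
      \<le> ennreal (16 * r\<^sup>2 * (1000 * pi ^ 3 * \<eta> * M * r ^ 5) / ((pi * r\<^sup>2 / 2) * (pi * r\<^sup>2 / 2)))"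
    using r by (intro ennreal_le_divide_of_mult_le) auto
  also have "16 * r\<^sup>2 * (1000 * pi ^ 3 * \<eta> * M * r ^ 5) / ((pi * r\<^sup>2 / 2) * (pi * r\<^sup>2 / 2))
      = 64000 * pi * \<eta> * M * r ^ 3"
    using r by (simp add: field_simps eval_nat_numeral)
  finally show ?thesis .
qed

section \<open>Testing the measure against the bump function\<close>

definition bump :: "complex \<Rightarrow> real \<Rightarrow> complex \<Rightarrow> real" where
  "bump w r \<zeta> = max 0 (r\<^sup>2 - (norm (\<zeta> - w))\<^sup>2)"

lemma borel_measurable_bump [measurable]: "bump w r \<in> borel_measurable borel"
  unfolding bump_def[abs_def] by measurable

text \<open>The disc formula integrated against \<mu>. Fubini applies because the integrand is at
  most r times the kernel on the disc, whose double integral is finite.\<close>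

lemma integral_bump:
  assumes r: "r > 0"
  shows "- of_real pi * I (\<lambda>\<zeta>. of_real (bump w r \<zeta>))
    = (\<integral>z. indicator (ball w r) z *\<^sub>R ((z - w) * cauchy_integral z) \<partial>lborel)"
proof -
  have int: "integrable (lborel \<Otimes>\<^sub>M T) (\<lambda>(z, \<zeta>). indicator (ball w r) z *\<^sub>R ((z - w) / (\<zeta> - z)))"
  proof (rule integrableI_bounded)
    interpret P: pair_sigma_finite "lborel :: complex measure" T ..
    show meas: "(\<lambda>(z, \<zeta>). indicator (ball w r) z *\<^sub>R ((z - w) / (\<zeta> - z))) \<in> borel_measurable (lborel \<Otimes>\<^sub>M T)"
      by measurable
    have "(\<integral>\<^sup>+p. ennreal (norm (case p of (z, \<zeta>) \<Rightarrow> indicator (ball w r) z *\<^sub>R ((z - w) / (\<zeta> - z)))) \<partial>(lborel \<Otimes>\<^sub>M T))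
        = (\<integral>\<^sup>+z. (\<integral>\<^sup>+\<zeta>. ennreal (norm (indicator (ball w r) z *\<^sub>R ((z - w) / (\<zeta> - z)))) \<partial>T) \<partial>lborel)"
      using meas by (subst nn_integral_fst[symmetric]) auto
    also have "\<dots> \<le> (\<integral>\<^sup>+z. ennreal r * (potential z * indicator (ball w r) z) \<partial>lborel)"
    proof (rule nn_integral_mono)
      fix z
      show "(\<integral>\<^sup>+\<zeta>. ennreal (norm (indicator (ball w r) z *\<^sub>R ((z - w) / (\<zeta> - z)))) \<partial>T)
          \<le> ennreal r * (potential z * indicator (ball w r) z)"
      proof (cases "z \<in> ball w r")
        case True
        have "(\<integral>\<^sup>+\<zeta>. ennreal (norm ((z - w) / (\<zeta> - z))) \<partial>T) \<le> (\<integral>\<^sup>+\<zeta>. ennreal r * cauchy_kernel \<zeta> z \<partial>T)"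
        proof (rule nn_integral_mono)
          fix \<zeta>
          have "ennreal (norm ((z - w) / (\<zeta> - z))) = ennreal (norm (z - w)) * ennreal (norm (1 / (\<zeta> - z)))"
            by (simp add: norm_divide ennreal_mult[symmetric])
          also have "\<dots> \<le> ennreal r * cauchy_kernel \<zeta> z"
            using True by (intro mult_mono ennreal_norm_inverse_le_cauchy_kernel ennreal_leI)
              (auto simp: dist_norm norm_minus_commute)
          finally show "ennreal (norm ((z - w) / (\<zeta> - z))) \<le> ennreal r * cauchy_kernel \<zeta> z" .
        qed
        also have "\<dots> = ennreal r * potential z"
          unfolding potential_def by (intro nn_integral_cmult) measurable
        finally show ?thesis using True by simp
      qed simp
    qed
    also have "\<dots> = ennreal r * (\<integral>\<^sup>+z. potential z * indicator (ball w r) z \<partial>lborel)"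
      by (rule nn_integral_cmult) measurable
    also have "(\<integral>\<^sup>+z. potential z * indicator (ball w r) z \<partial>lborel) = (\<integral>\<^sup>+\<zeta>. set_potential (ball w r) \<zeta> \<partial>T)"
      using nn_integral_kernel_swap[of "ball w r" "\<lambda>_. 1"] by (simp add: potential_def)
    also have "ennreal r * \<dots> < \<infinity>"
      using nn_integral_set_potential_finite[OF r, of w] by (simp add: ennreal_mult_less_top)
    finally show "(\<integral>\<^sup>+p. ennreal (norm (case p of (z, \<zeta>) \<Rightarrow> indicator (ball w r) z *\<^sub>R ((z - w) / (\<zeta> - z)))) \<partial>(lborel \<Otimes>\<^sub>M T)) < \<infinity>" .
  qed
  have "- of_real pi * I (\<lambda>\<zeta>. of_real (bump w r \<zeta>)) = I (\<lambda>\<zeta>. \<integral>z. indicator (ball w r) z *\<^sub>R ((z - w) / (\<zeta> - z)) \<partial>lborel)"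
    unfolding integral_disc_cauchy_kernel[OF r] integral_cmult[symmetric] bump_def by simp
  also have "\<dots> = (\<integral>z. I (\<lambda>\<zeta>. indicator (ball w r) z *\<^sub>R ((z - w) / (\<zeta> - z))) \<partial>lborel)"
    using int by (rule Fubini)
  also have "\<dots> = (\<integral>z. indicator (ball w r) z *\<^sub>R ((z - w) * cauchy_integral z) \<partial>lborel)"
  proof (intro Bochner_Integration.integral_cong refl)
    fix z
    have "I (\<lambda>\<zeta>. indicator (ball w r) z *\<^sub>R ((z - w) / (\<zeta> - z)))
        = I (\<lambda>\<zeta>. (of_real (indicator (ball w r) z) * (z - w)) * (1 / (\<zeta> - z)))"
      by (simp add: scaleR_conv_of_real)
    also have "\<dots> = indicator (ball w r) z *\<^sub>R ((z - w) * cauchy_integral z)"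
      by (simp only: integral_cmult cauchy_integral_def) (simp add: scaleR_conv_of_real)
    finally show "I (\<lambda>\<zeta>. indicator (ball w r) z *\<^sub>R ((z - w) / (\<zeta> - z)))
        = indicator (ball w r) z *\<^sub>R ((z - w) * cauchy_integral z)" .
  qed
  finally show ?thesis .
qed

text \<open>On \<open>G\<close> the Cauchy integral vanishes; on \<open>F\<close> the factor z - w
  is at most r, which raises r^3 to r^4. The pi of the disc formula cancels.\<close>

lemma norm_integral_bump_le:
  assumes F[measurable]: "F \<in> sets borel" and G[measurable]: "G \<in> sets borel"
    and FG: "F \<union> G = ball w r" "F \<inter> G = {}"
    and r: "r > 0" and \<eta>: "0 < \<eta>" "\<eta> \<le> 1" and mF: "emeasure lborel F \<le> ennreal (pi * \<eta>\<^sup>2 * r\<^sup>2)"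
    and mG: "ennreal (pi * r\<^sup>2 / 2) \<le> emeasure lborel G"
    and M: "M \<ge> 0" "\<And>s. s > 0 \<Longrightarrow> measure T (ball w s) \<le> M * s\<^sup>2"
    and zero: "\<And>z. z \<in> G \<Longrightarrow> potential z < \<infinity> \<and> cauchy_integral z = 0"
  shows "norm (I (\<lambda>\<zeta>. of_real (bump w r \<zeta>))) \<le> 64000 * \<eta> * M * r ^ 4"
proof -
  let ?h = "\<lambda>z. indicator (ball w r) z *\<^sub>R ((z - w) * cauchy_integral z)"
  have "ennreal (norm (\<integral>z. ?h z \<partial>lborel)) \<le> (\<integral>\<^sup>+z. ennreal (norm (?h z)) \<partial>lborel)"
  \<comment> \<open>A non-integrable \<open>?h\<close> has integral 0 by default, so the estimate
    also holds then.\<close>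
  proof (cases "integrable lborel ?h")
    case True
    then show ?thesis by (rule integral_norm_bound_ennreal)
  qed (simp add: not_integrable_integral_eq)
  also have "\<dots> \<le> (\<integral>\<^sup>+z. ennreal r * (ennreal (norm (cauchy_integral z)) * indicator F z) \<partial>lborel)"
  proof (rule nn_integral_mono)
    fix z
    show "ennreal (norm (?h z)) \<le> ennreal r * (ennreal (norm (cauchy_integral z)) * indicator F z)"
    proof (cases "z \<in> F")
      case True
      then have "z \<in> ball w r" using FG by blast
      then have "norm (z - w) \<le> r" by (auto simp: dist_norm norm_minus_commute)
      then have "norm (?h z) \<le> r * norm (cauchy_integral z)"
        using r by (auto simp: indicator_def norm_mult intro!: mult_right_mono)
      then show ?thesis
        using True r by (simp add: ennreal_mult[symmetric] del: norm_scaleR)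
    next
      case False
      then show ?thesis using FG zero[of z] by (cases "z \<in> ball w r") auto
    qed
  qed
  also have "\<dots> = ennreal r * (\<integral>\<^sup>+z. ennreal (norm (cauchy_integral z)) * indicator F z \<partial>lborel)"
    by (rule nn_integral_cmult) measurable
  also have "\<dots> \<le> ennreal r * ennreal (64000 * pi * \<eta> * M * r ^ 3)"
    using assms by (intro mult_left_mono nn_integral_cauchy_integral_le) auto
  also have "\<dots> = ennreal (r * (64000 * pi * \<eta> * M * r ^ 3))"
    using r \<eta> M by (simp add: ennreal_mult[symmetric])
  finally have "norm (\<integral>z. ?h z \<partial>lborel) \<le> r * (64000 * pi * \<eta> * M * r ^ 3)"
    using r \<eta> M by (subst (asm) ennreal_le_iff) auto
  moreover have "norm (\<integral>z. ?h z \<partial>lborel) = pi * norm (I (\<lambda>\<zeta>. of_real (bump w r \<zeta>)))"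
    unfolding integral_bump[OF r, symmetric] by (simp add: norm_mult)
  ultimately have "pi * norm (I (\<lambda>\<zeta>. of_real (bump w r \<zeta>))) \<le> pi * (64000 * \<eta> * M * r ^ 4)"
    by (simp add: eval_nat_numeral mult_ac)
  then show ?thesis by simp
qed

lemma eventually_norm_integral_bump_le:
  assumes dens: "density_point {z. has_cauchy_transform \<mu> z 0} w" and \<eta>: "0 < \<eta>" "\<eta> \<le> 1"
    and M: "M \<ge> 0" "\<And>s. s > 0 \<Longrightarrow> measure T (ball w s) \<le> M * s\<^sup>2"
  shows "\<forall>\<^sub>F r in at_right 0. norm (I (\<lambda>\<zeta>. of_real (bump w r \<zeta>))) \<le> 64000 * \<eta> * M * r ^ 4"
proof -
  define E where "E = {z. has_cauchy_transform \<mu> z 0}"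
  \<comment> \<open>The two thresholds have separate purposes: 1 - \<eta>^2 bounds the area of
    \<open>F\<close>, and 1/2 gives \<open>G\<close> at least half the disc.\<close>
  have "\<forall>\<^sub>F r in at_right 0. max (1 - \<eta>\<^sup>2) (1/2) < measure lebesgue (E \<inter> ball w r) / measure lebesgue (ball w r)"
    using dens \<eta> unfolding density_point_def E_def by (intro order_tendstoD(1)) auto
  then show ?thesis
    using eventually_at_right_less[of "0::real"]
  proof eventually_elim
    case (elim r)
    then have r: "r > 0" by simp
    let ?S = "E \<inter> ball w r"
    have m: "max (1 - \<eta>\<^sup>2) (1/2) * (pi * r\<^sup>2) < measure lebesgue ?S"
      using elim r by (simp add: measure_ball_complex less_divide_eq del: max_less_iff_conj)
    moreover have "0 < max (1 - \<eta>\<^sup>2) (1/2) * (pi * r\<^sup>2)"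
      using r by (intro mult_pos_pos) (auto simp: less_max_iff_disj)
    ultimately have "measure lebesgue ?S \<noteq> 0" by linarith
    \<comment> \<open>Outside the Lebesgue measurable sets \<open>measure\<close> is 0, so the
      positive value proves measurability.\<close>
    then have S: "?S \<in> sets lebesgue" using measure_notin_sets by blast
    \<comment> \<open>Passing to a Borel subset and then removing the points of infinite potential
      costs no area; on what is left the principal value is a genuine integral.\<close>
    define G0 where "G0 = main_part lborel ?S"
    define G where "G = {z\<in>G0. potential z < \<infinity>}"
    have G0[measurable]: "G0 \<in> sets borel"
      using main_part_sets[OF S] by (simp add: G0_def)
    have G[measurable]: "G \<in> sets borel" unfolding G_def by measurable
    have G0_sub: "G0 \<subseteq> ?S"
      using main_part_null_part_Un[OF S] unfolding G0_def by blast
    have "emeasure lborel G = emeasure lborel G0"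
      using AE_potential_finite by (intro emeasure_eq_AE) (auto simp: G_def elim!: eventually_mono)
    also have "\<dots> = emeasure lebesgue ?S"
      unfolding G0_def using S by (simp add: emeasure_completion)
    finally have eq: "emeasure lborel G = emeasure lebesgue ?S" .
    then have meq: "measure lborel G = measure lebesgue ?S" by (simp add: Sigma_Algebra.measure_def)
    have Gsub: "G \<subseteq> ball w r" using G0_sub by (auto simp: G_def)
    have finG: "emeasure lborel G \<noteq> \<infinity>"
      using emeasure_mono[OF Gsub, of lborel] r by (auto simp: emeasure_ball_complex top_unique)
    then have emG: "emeasure lborel G = ennreal (measure lborel G)"
      by (simp add: emeasure_eq_ennreal_measure)
    define F where "F = ball w r - G"
    have F[measurable]: "F \<in> sets borel" unfolding F_def by measurable
    have "emeasure lborel F = emeasure lborel (ball w r) - emeasure lborel G"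
      unfolding F_def using Gsub finG by (intro emeasure_Diff) auto
    also have "\<dots> = ennreal (pi * r\<^sup>2 - measure lborel G)"
      using r by (simp add: emeasure_ball_complex emG ennreal_minus)
    also have "\<dots> \<le> ennreal (pi * \<eta>\<^sup>2 * r\<^sup>2)"
    proof (rule ennreal_leI)
      have "(1 - \<eta>\<^sup>2) * (pi * r\<^sup>2) \<le> max (1 - \<eta>\<^sup>2) (1/2) * (pi * r\<^sup>2)"
        by (intro mult_right_mono) auto
      then show "pi * r\<^sup>2 - measure lborel G \<le> pi * \<eta>\<^sup>2 * r\<^sup>2"
        using m meq by (simp add: algebra_simps)
    qed
    finally have mF: "emeasure lborel F \<le> ennreal (pi * \<eta>\<^sup>2 * r\<^sup>2)" .
    have mG: "ennreal (pi * r\<^sup>2 / 2) \<le> emeasure lborel G"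
      unfolding emG
    proof (rule ennreal_leI)
      have "(1/2) * (pi * r\<^sup>2) \<le> max (1 - \<eta>\<^sup>2) (1/2) * (pi * r\<^sup>2)"
        by (intro mult_right_mono) auto
      then show "pi * r\<^sup>2 / 2 \<le> measure lborel G" using m meq by linarith
    qed
    have zero: "potential z < \<infinity> \<and> cauchy_integral z = 0" if "z \<in> G" for z
      using that G0_sub cauchy_integral_eq_0[of z] by (auto simp: G_def E_def)
    have "F \<union> G = ball w r" "F \<inter> G = {}" using Gsub by (auto simp: F_def)
    then show ?case
      using norm_integral_bump_le[OF F G _ _ r \<eta> mF mG M zero] by blast
  qed
qed

section \<open>From bump functions back to discs\<close>

lemma integrable_bounded:
  fixes f :: "complex \<Rightarrow> complex"
  assumes [measurable]: "f \<in> borel_measurable borel" and "\<And>x. norm (f x) \<le> B"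
  shows "integrable T f"
  by (rule integrable_const_bound[where B = B]) (use assms in auto)

text \<open>The coefficient is r^2 - (a r)^2, the height of the difference of the bumps on the inner
  disc. On the ring the difference does not exceed this height in modulus, so the ring costs at most
  the height times its mass, with the 4 of \<open>norm_integral_le\<close>.\<close>

lemma norm_measure_ball_le:
  assumes r: "r > 0" and a: "0 < a" "a < 1"
  shows "r\<^sup>2 * (1 - a\<^sup>2) * norm (\<mu> (ball w (a * r)))
    \<le> norm (I (\<lambda>\<zeta>. of_real (bump w r \<zeta>))) + norm (I (\<lambda>\<zeta>. of_real (bump w (a * r) \<zeta>)))
      + 4 * (r\<^sup>2 * (1 - a\<^sup>2)) * (measure T (ball w r) - measure T (ball w (a * r)))"
proof -
  define b where "b = r\<^sup>2 * (1 - a\<^sup>2)"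
  have b: "b \<ge> 0" using a by (simp add: b_def power_le_one)
  have ar: "a * r < r" using a r by simp
  define g where "g \<zeta> = bump w r \<zeta> - bump w (a * r) \<zeta>" for \<zeta>
  have g_in: "g \<zeta> = b" if "\<zeta> \<in> ball w (a * r)" for \<zeta>
  proof -
    have d: "norm (\<zeta> - w) \<le> a * r" using that by (simp add: dist_norm norm_minus_commute)
    then have "(norm (\<zeta> - w))\<^sup>2 \<le> (a * r)\<^sup>2" "(norm (\<zeta> - w))\<^sup>2 \<le> r\<^sup>2"
      using ar by (intro power_mono; simp)+
    then show ?thesis by (simp add: g_def bump_def b_def algebra_simps power_mult_distrib)
  qed
  have g_out: "g \<zeta> = 0" if "\<zeta> \<notin> ball w r" for \<zeta>
  proof -
    have d: "r \<le> norm (\<zeta> - w)" using that by (simp add: dist_norm norm_minus_commute)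
    then have "(a * r)\<^sup>2 \<le> (norm (\<zeta> - w))\<^sup>2" "r\<^sup>2 \<le> (norm (\<zeta> - w))\<^sup>2"
      using order_trans[OF less_imp_le[OF ar] d] d a r by (auto intro!: power_mono)
    then show ?thesis by (simp add: g_def bump_def)
  qed
  have g_bnd: "\<bar>g \<zeta>\<bar> \<le> b" for \<zeta>
  proof -
    have "(a * r)\<^sup>2 \<le> r\<^sup>2" using ar a r by (intro power_mono) auto
    then show ?thesis
      by (auto simp: g_def bump_def b_def max_def algebra_simps power_mult_distrib)
  qed
  have [measurable]: "g \<in> borel_measurable borel" unfolding g_def[abs_def] by measurable
  have sub: "ball w (a * r) \<subseteq> ball w r" using ar by (auto simp del: mult_less_cancel_right)
  let ?A = "ball w r - ball w (a * r)"
  have bump_bnd: "norm (of_real (bump w s \<zeta>) :: complex) \<le> s\<^sup>2" for s \<zeta>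
    by (auto simp: bump_def max_def)
  have bump_int: "integrable T (\<lambda>\<zeta>. of_real (bump w s \<zeta>) :: complex)" for s
    using bump_bnd by (intro integrable_bounded) auto
  have "of_real b * \<mu> (ball w (a * r)) = I (\<lambda>\<zeta>. of_real b * indicator (ball w (a * r)) \<zeta>)"
    by (simp add: integral_cmult integral_indicator)
  also have "\<dots> = I (\<lambda>\<zeta>. of_real (g \<zeta>) - of_real (g \<zeta>) * indicator ?A \<zeta>)"
  proof (rule arg_cong[where f = I], rule ext)
    fix \<zeta>
    show "of_real b * indicator (ball w (a * r)) \<zeta> = (of_real (g \<zeta>) - of_real (g \<zeta>) * indicator ?A \<zeta> :: complex)"
      using g_in[of \<zeta>] g_out[of \<zeta>] sub by (auto simp: indicator_def simp del: mem_ball)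
  qed
  also have "\<dots> = I (\<lambda>\<zeta>. of_real (g \<zeta>)) - I (\<lambda>\<zeta>. of_real (g \<zeta>) * indicator ?A \<zeta>)"
    using g_bnd b by (intro integral_diff integrable_bounded[where B = b]) (auto simp: indicator_def)
  also have "I (\<lambda>\<zeta>. of_real (g \<zeta>)) = I (\<lambda>\<zeta>. of_real (bump w r \<zeta>)) - I (\<lambda>\<zeta>. of_real (bump w (a * r) \<zeta>))"
    unfolding g_def of_real_diff by (intro integral_diff bump_int)
  finally have eq: "of_real b * \<mu> (ball w (a * r)) = I (\<lambda>\<zeta>. of_real (bump w r \<zeta>))
      - I (\<lambda>\<zeta>. of_real (bump w (a * r) \<zeta>)) - I (\<lambda>\<zeta>. of_real (g \<zeta>) * indicator ?A \<zeta>)" .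
  have "ennreal (norm (I (\<lambda>\<zeta>. of_real (g \<zeta>) * indicator ?A \<zeta>)))
      \<le> 4 * (\<integral>\<^sup>+\<zeta>. ennreal (norm (of_real (g \<zeta>) * indicator ?A \<zeta> :: complex)) \<partial>T)"
    by (rule norm_integral_le)
  also have "\<dots> \<le> 4 * (\<integral>\<^sup>+\<zeta>. ennreal b * indicator ?A \<zeta> \<partial>T)"
    using g_bnd by (intro mult_left_mono nn_integral_mono) (auto simp: indicator_def intro!: ennreal_leI)
  also have "\<dots> = ennreal (4 * b * measure T ?A)"
    using b by (subst nn_integral_cmult_indicator) (auto simp: emeasure_eq_measure ennreal_mult mult.assoc)
  finally have "norm (I (\<lambda>\<zeta>. of_real (g \<zeta>) * indicator ?A \<zeta>)) \<le> 4 * b * measure T ?A"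
    using b by (subst (asm) ennreal_le_iff) auto
  also have "measure T ?A = measure T (ball w r) - measure T (ball w (a * r))"
    using sub by (intro finite_measure_Diff) auto
  finally have G: "norm (I (\<lambda>\<zeta>. of_real (g \<zeta>) * indicator ?A \<zeta>))
      \<le> 4 * b * (measure T (ball w r) - measure T (ball w (a * r)))" .
  have "b * norm (\<mu> (ball w (a * r))) = norm (of_real b * \<mu> (ball w (a * r)))"
    using b by (simp add: norm_mult)
  also have "\<dots> \<le> norm (I (\<lambda>\<zeta>. of_real (bump w r \<zeta>))) + norm (I (\<lambda>\<zeta>. of_real (bump w (a * r) \<zeta>)))
      + norm (I (\<lambda>\<zeta>. of_real (g \<zeta>) * indicator ?A \<zeta>))"
    unfolding eq by (rule order_trans[OF norm_triangle_ineq4 add_right_mono[OF norm_triangle_ineq4]])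
  finally show ?thesis using G unfolding b_def by linarith
qed

text \<open>Small radii are governed by the limit, large ones by the finiteness of \<open>T\<close>.
  The bound must hold at every scale because the dyadic sum reaches arbitrarily far out.\<close>

lemma measure_ball_le_square:
  assumes lim: "((\<lambda>r. measure T (ball w r) / r\<^sup>2) \<longlongrightarrow> D) (at_right 0)"
  shows "\<exists>M\<ge>0. \<forall>s>0. measure T (ball w s) \<le> M * s\<^sup>2"
proof -
  have "\<forall>\<^sub>F r in at_right 0. measure T (ball w r) / r\<^sup>2 < \<bar>D\<bar> + 1"
    using lim by (rule order_tendstoD) simp
  then obtain s0 where s0: "s0 > 0" "\<And>r. 0 < r \<Longrightarrow> r < s0 \<Longrightarrow> measure T (ball w r) / r\<^sup>2 < \<bar>D\<bar> + 1"
    unfolding eventually_at_right_field by blast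
  define M where "M = max (\<bar>D\<bar> + 1) (measure T UNIV / s0\<^sup>2)"
  have "measure T (ball w s) \<le> M * s\<^sup>2" if s: "s > 0" for s
  proof (cases "s < s0")
    case True
    then have "measure T (ball w s) / s\<^sup>2 \<le> M" using s0(2)[OF s] by (simp add: M_def)
    then show ?thesis using s by (simp add: divide_le_eq)
  next
    case False
    have "measure T (ball w s) \<le> measure T UNIV" by (intro finite_measure_mono) auto
    also have "\<dots> = measure T UNIV / s0\<^sup>2 * s0\<^sup>2" using s0 by simp
    also have "\<dots> \<le> M * s\<^sup>2"
      using False s0 by (intro mult_mono power_mono) (auto simp: M_def le_max_iff_disj)
    finally show ?thesis .
  qed
  moreover have "M \<ge> 0" by (simp add: M_def le_max_iff_disj)
  ultimately show ?thesis by blast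
qed

lemma measure_ball_smallo_square:
  assumes dens: "density_point {z. has_cauchy_transform \<mu> z 0} w"
    and lim: "((\<lambda>r. measure T (ball w r) / r\<^sup>2) \<longlongrightarrow> D) (at_right 0)"
  shows "((\<lambda>r. \<mu> (ball w r) /\<^sub>R r\<^sup>2) \<longlongrightarrow> 0) (at_right 0)"
proof (rule tendstoI)
  fix e :: real assume e: "e > 0"
  obtain M where M: "M \<ge> 0" "\<And>s. s > 0 \<Longrightarrow> measure T (ball w s) \<le> M * s\<^sup>2"
    using measure_ball_le_square[OF lim] by blast
  have "D \<ge> 0"
    using lim by (rule tendsto_lowerbound) (auto intro: always_eventually)
  \<comment> \<open>The ratio \<open>a\<close> is fixed before \<eta>. This expression is the limit
    of the ring's contribution divided by the bump height and by (a r)^2, and it vanishes as a tends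
    to 1.\<close>
  have "((\<lambda>a. 4 * D * (1 - a\<^sup>2) / a\<^sup>2) \<longlongrightarrow> 4 * D * (1 - 1\<^sup>2) / 1\<^sup>2) (at_left (1::real))"
    by (intro tendsto_intros) auto
  then have "\<forall>\<^sub>F a in at_left 1. 4 * D * (1 - a\<^sup>2) / a\<^sup>2 < e / 3"
    using e by (intro order_tendstoD(2)) auto
  moreover have "\<forall>\<^sub>F a in at_left 1. 0 < a \<and> a < (1::real)"
    by (subst eventually_at_left[of 0]) (auto intro!: exI[of _ 0])
  ultimately have "\<forall>\<^sub>F a in at_left (1::real). 4 * D * (1 - a\<^sup>2) / a\<^sup>2 < e / 3 \<and> 0 < a \<and> a < 1"
    by eventually_elim auto
  then obtain a where a: "4 * D * (1 - a\<^sup>2) / a\<^sup>2 < e / 3" "0 < a" "a < 1"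
    using eventually_happens[of _ "at_left (1::real)"] trivial_limit_at_left_real by blast
  have a2: "0 < a\<^sup>2" "a\<^sup>2 < 1" using a by (auto simp: power_less_one_iff abs_square_less_1)
  \<comment> \<open>After the same division the two bump integrals contribute at most c \<eta>, with
    128000 = 2 * 64000. When M is positive, \<open>c\<close> blows up as a tends to 1, so \<eta> has
    to be chosen after \<open>a\<close>.\<close>
  define c where "c = 128000 * M / ((1 - a\<^sup>2) * a\<^sup>2)"
  have c: "c \<ge> 0" using a2 M by (simp add: c_def)
  \<comment> \<open>The denominator has c + 1 because \<open>c\<close> is 0 when M is 0; the bump
    estimate demands the cap at 1.\<close>
  define \<eta> where "\<eta> = min 1 (e / (3 * (c + 1)))"
  have \<eta>: "0 < \<eta>" "\<eta> \<le> 1" using e c by (auto simp: \<eta>_def)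
  have "c * \<eta> \<le> c * (e / (3 * (c + 1)))" using c by (intro mult_left_mono) (auto simp: \<eta>_def)
  also have "\<dots> < (c + 1) * (e / (3 * (c + 1)))" using c e by (intro mult_strict_right_mono) auto
  also have "(c + 1) * (e / (3 * (c + 1))) = e / 3"
  proof -
    have "d * (e / (3 * d)) = e / 3" if "d > 0" for d using that by simp
    then show ?thesis using c by (smt (verit))
  qed
  finally have c\<eta>: "c * \<eta> < e / 3" .
  have scale: "filterlim (\<lambda>r. k * r) (at_right 0) (at_right (0::real))" if "k > 0" for k
  proof (rule filterlim_at_withinI)
    have "((\<lambda>r. k * r) \<longlongrightarrow> k * 0) (at_right (0::real))" by (intro tendsto_intros)
    then show "((\<lambda>r. k * r) \<longlongrightarrow> 0) (at_right (0::real))" by simp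
    show "\<forall>\<^sub>F r in at_right 0. k * r \<in> {0<..} - {0}"
      using eventually_at_right_less[of "0::real"] by eventually_elim (use that in auto)
  qed
  have bump: "\<forall>\<^sub>F r in at_right 0. norm (I (\<lambda>\<zeta>. of_real (bump w r \<zeta>))) \<le> 64000 * \<eta> * M * r ^ 4"
    using dens \<eta> M by (rule eventually_norm_integral_bump_le)
  have lim_a: "((\<lambda>r. measure T (ball w (a * r)) / (a * r)\<^sup>2) \<longlongrightarrow> D) (at_right 0)"
    by (rule filterlim_compose[OF lim scale]) (rule a)
  have "((\<lambda>r. 4 / a\<^sup>2 * (measure T (ball w r) / r\<^sup>2 - a\<^sup>2 * (measure T (ball w (a * r)) / (a * r)\<^sup>2)))
      \<longlongrightarrow> 4 / a\<^sup>2 * (D - a\<^sup>2 * D)) (at_right 0)"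
    by (intro tendsto_intros lim lim_a)
  moreover have "4 / a\<^sup>2 * (D - a\<^sup>2 * D) < e / 3" using a by (simp add: algebra_simps)
  ultimately have ann: "\<forall>\<^sub>F r in at_right 0.
      4 / a\<^sup>2 * (measure T (ball w r) / r\<^sup>2 - a\<^sup>2 * (measure T (ball w (a * r)) / (a * r)\<^sup>2)) < e / 3"
    by (rule order_tendstoD(2))
  have "\<forall>\<^sub>F r in at_right 0. norm (\<mu> (ball w (a * r))) / (a * r)\<^sup>2 < e"
    using bump eventually_compose_filterlim[OF bump scale[OF a(2)]] ann
      eventually_at_right_less[of "0::real"]
  proof eventually_elim
    case (elim r)
    then have r: "r > 0" by simp
    define b where "b = r\<^sup>2 * (1 - a\<^sup>2)"
    have b: "b > 0" using r a2 by (simp add: b_def)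
    have "(a * r) ^ 4 \<le> r ^ 4" using a r by (intro power_mono) auto
    then have "64000 * \<eta> * M * (a * r) ^ 4 \<le> 64000 * \<eta> * M * r ^ 4"
      using \<eta> M by (intro mult_left_mono) auto
    then have "b * norm (\<mu> (ball w (a * r))) \<le> 128000 * \<eta> * M * r ^ 4
        + 4 * b * (measure T (ball w r) - measure T (ball w (a * r)))"
      using norm_measure_ball_le[OF r a(2,3), of w] elim(1,2) unfolding b_def by linarith
    then have "norm (\<mu> (ball w (a * r))) \<le> (128000 * \<eta> * M * r ^ 4
        + 4 * b * (measure T (ball w r) - measure T (ball w (a * r)))) / b"
      using b by (simp add: pos_le_divide_eq mult.commute)
    then have "norm (\<mu> (ball w (a * r))) / (a * r)\<^sup>2 \<le> (128000 * \<eta> * M * r ^ 4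
        + 4 * b * (measure T (ball w r) - measure T (ball w (a * r)))) / b / (a * r)\<^sup>2"
      by (rule divide_right_mono) simp
    also have "\<dots> = c * \<eta> + 4 / a\<^sup>2 * (measure T (ball w r) / r\<^sup>2 - a\<^sup>2 * (measure T (ball w (a * r)) / (a * r)\<^sup>2))"
    proof -
      have e1: "128000 * \<eta> * M * r ^ 4 / b / (a * r)\<^sup>2 = c * \<eta>"
        using r a2 a by (simp add: b_def c_def divide_simps power_mult_distrib)
      have e2: "4 * b * x / b / (a * r)\<^sup>2 = 4 / a\<^sup>2 * (x / r\<^sup>2)" for x
        using b by (simp add: power_mult_distrib)
      have e3: "a\<^sup>2 * (y / (a * r)\<^sup>2) = y / r\<^sup>2" for y
        using a by (simp add: power_mult_distrib)
      show ?thesis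
        unfolding add_divide_distrib e1 e2 e3 by (simp add: diff_divide_distrib)
    qed
    also have "\<dots> < e" using c\<eta> elim(3) e by linarith
    finally show ?case .
  qed
  \<comment> \<open>The estimate so far concerns the radii a r; substituting r / a turns it into one
    for all small radii.\<close>
  then have "\<forall>\<^sub>F r in at_right 0. norm (\<mu> (ball w (a * (1 / a * r)))) / (a * (1 / a * r))\<^sup>2 < e"
    by (rule eventually_compose_filterlim[OF _ scale]) (use a(2) in simp)
  moreover have "a * (1 / a * r) = r" for r using a(2) by simp
  ultimately have "\<forall>\<^sub>F r in at_right 0. norm (\<mu> (ball w r)) / r\<^sup>2 < e" by (simp only:)
  then show "\<forall>\<^sub>F r in at_right 0. dist (\<mu> (ball w r) /\<^sub>R r\<^sup>2) 0 < e"
    by (simp add: divide_inverse mult.commute)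
qed

end

theorem corollary4p3:
  fixes \<mu> :: "complex set \<Rightarrow> complex" and E :: "complex set" and w :: complex and L :: real
  assumes "complex_measure \<mu>"
    and "E = {z. has_cauchy_transform \<mu> z 0}"
    and "density_point E w"
    and "has_radon_derivative (measure (total_variation \<mu>)) L w"
    and "L \<noteq> 0"
  shows "(\<lambda>r. \<mu> (ball w r))
           \<in> o[at_right 0](\<lambda>r. complex_of_real (measure (total_variation \<mu>) (ball w r)))
         \<and> has_radon_derivative \<mu> 0 w"
proof -
  let ?T = "total_variation \<mu>"
  have area: "\<forall>\<^sub>F r in at_right 0. measure lebesgue (ball w r) = pi * r\<^sup>2"
    using eventually_at_right_less[of "0::real"]
    by eventually_elim (simp add: measure_ball_complex)
  have lim: "((\<lambda>r. measure ?T (ball w r) /\<^sub>R measure lebesgue (ball w r)) \<longlongrightarrow> L) (at_right 0)"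
    using assms(4) by (simp only: has_radon_derivative_def)
  then have "\<forall>\<^sub>F r in at_right 0. measure ?T (ball w r) /\<^sub>R measure lebesgue (ball w r) \<noteq> 0"
    using assms(5) by (rule tendsto_imp_eventually_ne)
  then have ne: "\<forall>\<^sub>F r in at_right 0. measure ?T (ball w r) \<noteq> 0"
    by eventually_elim auto
  \<comment> \<open>A single disc of nonzero variation shows that \<open>measure_of\<close> did not
    fall back on the null measure, so the variation has its intended values and is finite.\<close>
  then obtain r0 where r0: "measure ?T (ball w r0) \<noteq> 0"
    using eventually_happens[of _ "at_right (0::real)"] by auto
  interpret finite_measure ?T
    by (rule finite_measure_total_variation[OF assms(1) r0])
  interpret dominated_complex_measure ?T \<mu>
    by unfold_locales (use assms(1) norm_complex_measure_le_total_variation[OF assms(1) r0] in auto)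
  \<comment> \<open>Dividing by r^2 instead of by the area multiplies the derivative by pi.\<close>
  have "((\<lambda>r. pi * (measure ?T (ball w r) /\<^sub>R measure lebesgue (ball w r))) \<longlongrightarrow> pi * L) (at_right 0)"
    by (intro tendsto_intros lim)
  then have lim': "((\<lambda>r. measure ?T (ball w r) / r\<^sup>2) \<longlongrightarrow> pi * L) (at_right 0)"
    by (rule Lim_transform_eventually) (use area in \<open>auto elim!: eventually_mono simp: field_simps\<close>)
  have \<mu>_lim: "((\<lambda>r. \<mu> (ball w r) /\<^sub>R r\<^sup>2) \<longlongrightarrow> 0) (at_right 0)"
    using measure_ball_smallo_square[OF _ lim'] assms(2,3) by simp
  have "((\<lambda>r. (1 / pi) *\<^sub>R (\<mu> (ball w r) /\<^sub>R r\<^sup>2)) \<longlongrightarrow> (1 / pi) *\<^sub>R 0) (at_right 0)"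
    by (intro tendsto_intros \<mu>_lim)
  then have "((\<lambda>r. \<mu> (ball w r) /\<^sub>R measure lebesgue (ball w r)) \<longlongrightarrow> 0) (at_right 0)"
    unfolding scaleR_zero_right
    by (rule Lim_transform_eventually) (use area in \<open>auto elim!: eventually_mono simp: divide_inverse mult.commute\<close>)
  \<comment> \<open>Numerator and denominator are compared on the common scale r^2. That L is
    nonzero enters a second time, as the limit of the denominator.\<close>
  moreover have "((\<lambda>r. (\<mu> (ball w r) /\<^sub>R r\<^sup>2) / of_real (measure ?T (ball w r) / r\<^sup>2)) \<longlongrightarrow> 0 / of_real (pi * L)) (at_right 0)"
    using assms(5) by (intro tendsto_intros \<mu>_lim lim') auto
  then have "((\<lambda>r. \<mu> (ball w r) / of_real (measure ?T (ball w r))) \<longlongrightarrow> 0) (at_right 0)"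
    unfolding div_0
  proof (rule Lim_transform_eventually)
    show "\<forall>\<^sub>F r in at_right 0. (\<mu> (ball w r) /\<^sub>R r\<^sup>2) / of_real (measure ?T (ball w r) / r\<^sup>2)
        = \<mu> (ball w r) / of_real (measure ?T (ball w r))"
      using eventually_at_right_less[of "0::real"]
      by eventually_elim (simp add: scaleR_conv_of_real field_simps)
  qed
  then have "(\<lambda>r. \<mu> (ball w r)) \<in> o[at_right 0](\<lambda>r. complex_of_real (measure ?T (ball w r)))"
    using ne by (intro smalloI_tendsto) (auto elim!: eventually_mono)
  ultimately show ?thesis by (simp add: has_radon_derivative_def)
qed

end
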